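(* Let $A,B$ be finite-dimensional unital $C^*$-algebras, let $f\colon B\to\mathcal{Z}(A)$ be a positive unital map into the center of $A$, and let $e\in[0,1]_{A\otimes B}$ be an effect. Suppose that $\mathrm{gr}(f)(e)$ and $\mathrm{gr}(f)(1-e)$ are invertible in $A$. Then there exist unique positive unital maps $f|e,\ f|e^{\perp}\colon B\to A$ such that $$\mathrm{char}_{\mathrm{gr}(f)(e)}\circ\big((f|e)\times(f|e^{\perp})\big)=f\wedge e\colon\ B\times B\to A .$$ They are given, for $b\in B$, by the formulas $$(f|e)(b)=\frac{1}{\sqrt{\mathrm{gr}(f)(e)}}\cdot(f\wedge e)(b,0)\cdot\frac{1}{\sqrt{\mathrm{gr}(f)(e)}},\qquad (f|e^{\perp})(b)=\frac{1}{\sqrt{\mathrm{gr}(f)(1-e)}}\cdot(f\wedge e)(0,b)\cdot\frac{1}{\sqrt{\mathrm{gr}(f)(1-e)}} .$$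
   Context: All $C^*$-algebras are unital, over $\mathbb{C}$, and finite-dimensional. A positive unital map is a linear map between $C^*$-algebras that preserves positive elements and the unit. $\mathcal{Z}(A)=\{a\in A\mid \forall b\in A,\ ab=ba\}$ is the center. $A\otimes B$ is the $C^*$-algebra tensor product (for finite-dimensional algebras, the algebraic tensor product with $(a_1\otimes b_1)(a_2\otimes b_2)=a_1a_2\otimes b_1b_2$ and $(a\otimes b)^*=a^*\otimes b^*$). $B\times B$ is the direct sum $C^*$-algebra with pointwise operations, and $(g_1\times g_2)(b_1,b_2)=(g_1(b_1),g_2(b_2))$. The effects of $A$ are $[0,1]_A=\{a\in A\mid 0\le a\le 1\}$, with $e^{\perp}=1-e$. For $e\in[0,1]_A$ the characteristic map is $\mathrm{char}_e\colon A\times A\to A$, $\mathrm{char}_e(a,a')=\sqrt{e}\,a\,\sqrt{e}+\sqrt{1-e}\,a'\,\sqrt{1-e}$. For positive unital $f\colon B\to\mathcal{Z}(A)$, the graph map $\mathrm{gr}(f)\colon A\otimes B\to A$ is the positive unital map determined linearly by $\mathrm{gr}(f)(a\otimes b)=a\cdot f(b)=f(b)\cdot a$; in particular it maps effects to effects. The joint map $f\wedge e\colon B\times B\to A$ is $f\wedge e=\mathrm{gr}(f)\circ\mathrm{char}_e\circ(\kappa_2\times\kappa_2)$ with $\kappa_2\colon B\to A\otimes B$, $\kappa_2(b)=1\otimes b$; that is, $(f\wedge e)(b_1,b_2)=\mathrm{gr}(f)\big(\sqrt{e}\,(1\otimes b_1)\sqrt{e}+\sqrt{1-e}\,(1\otimes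 b_2)\sqrt{1-e}\big)$. For a positive invertible element $a$, $\frac{1}{\sqrt a}$ denotes the inverse of its positive square root. *)

theory Defs
  imports Complex_Main "HOL-Library.Multiset"
begin

section \<open>Finite-dimensional unital C*-algebras\<close>

class scaleC =
  fixes scaleC :: "complex \<Rightarrow> 'a \<Rightarrow> 'a"  (infixr "*\<^sub>C" 75)

class complex_vector = ab_group_add + scaleC +
  assumes scaleC_add_right: "c *\<^sub>C (x + y) = c *\<^sub>C x + c *\<^sub>C y"
    and scaleC_add_left: "(c + d) *\<^sub>C x = c *\<^sub>C x + d *\<^sub>C x"
    and scaleC_scaleC: "c *\<^sub>C d *\<^sub>C x = (c * d) *\<^sub>C x"
    and scaleC_one: "1 *\<^sub>C x = x"

interpretation complex_vector:
  vector_space "scaleC :: complex \<Rightarrow> 'a \<Rightarrow> 'a::complex_vector"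
  by standard (simp_all add: scaleC_add_right scaleC_add_left scaleC_scaleC scaleC_one)

abbreviation clinear :: "('a::complex_vector \<Rightarrow> 'b::complex_vector) \<Rightarrow> bool"
  where "clinear \<equiv> Vector_Spaces.linear scaleC scaleC"

text \<open>
  The unit is given by \<^class>\<open>monoid_mult\<close> rather than \<^class>\<open>ring_1\<close>, which would exclude the
  zero algebra.
\<close>

class unital_star_algebra = complex_vector + ring + monoid_mult +
  fixes star :: "'a \<Rightarrow> 'a"
  assumes mult_scaleC_left: "(c *\<^sub>C x) * y = c *\<^sub>C (x * y)"
    and mult_scaleC_right: "x * (c *\<^sub>C y) = c *\<^sub>C (x * y)"
    and star_add: "star (x + y) = star x + star y"
    and star_scaleC: "star (c *\<^sub>C x) = cnj c *\<^sub>C star x"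
    and star_mult: "star (x * y) = star y * star x"
    and star_star: "star (star x) = x"

class cstar_algebra = unital_star_algebra + real_normed_algebra + banach +
  assumes scaleR_scaleC: "r *\<^sub>R x = complex_of_real r *\<^sub>C x"
    and norm_scaleC: "norm (c *\<^sub>C x) = cmod c * norm x"
    and cstar_identity: "norm (star x * x) = norm x ^ 2"

class fd_cstar_algebra = cstar_algebra +
  assumes finite_dim: "\<exists>S. finite S \<and> (\<forall>x. \<exists>c. x = (\<Sum>s\<in>S. c s *\<^sub>C s))"

instantiation complex :: fd_cstar_algebra
begin

definition scaleC_complex :: "complex \<Rightarrow> complex \<Rightarrow> complex"
  where "scaleC_complex c x = c * x"

definition star_complex :: "complex \<Rightarrow> complex"
  where "star_complex = cnj"

instance
proof
  show "\<exists>S::complex set. finite S \<and> (\<forall>x. \<exists>c. x = (\<Sum>s\<in>S. c s *\<^sub>C s))"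
    by (intro exI[of _ "{1}"]) (auto simp: scaleC_complex_def)
qed (auto simp: scaleC_complex_def star_complex_def algebra_simps norm_mult power2_eq_square
      scaleR_conv_of_real)

end


section \<open>The algebraic tensor product\<close>

text \<open>
  Formal finite sums of pairs modulo the congruence generated by the bilinearity relations. Scalar
  coefficients are absorbed into the first components.
\<close>

inductive tensor_eq ::
    "('a::complex_vector \<times> 'b::complex_vector) multiset \<Rightarrow> ('a \<times> 'b) multiset \<Rightarrow> bool"
  where
    refl: "tensor_eq M M"
  | sym: "tensor_eq M N \<Longrightarrow> tensor_eq N M"
  | trans: "tensor_eq M N \<Longrightarrow> tensor_eq N P \<Longrightarrow> tensor_eq M P"
  | cong: "tensor_eq M M' \<Longrightarrow> tensor_eq N N' \<Longrightarrow> tensor_eq (M + N) (M' + N')"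
  | zero: "tensor_eq {#(0, b)#} {#}"
  | add_left: "tensor_eq {#(a + a', b)#} {#(a, b), (a', b)#}"
  | add_right: "tensor_eq {#(a, b + b')#} {#(a, b), (a, b')#}"
  | scale: "tensor_eq {#(c *\<^sub>C a, b)#} {#(a, c *\<^sub>C b)#}"

quotient_type (overloaded) ('a, 'b) tensor =
  "('a::complex_vector \<times> 'b::complex_vector) multiset" / tensor_eq
  by (intro equivpI reflpI sympI transpI) (blast intro: tensor_eq.intros)+

lift_definition pure_tensor :: "'a::complex_vector \<Rightarrow> 'b::complex_vector \<Rightarrow> ('a, 'b) tensor"
    (infix "\<otimes>\<^sub>C" 72)
  is "\<lambda>a b. {#(a, b)#}" .

lemma tensor_eq_map:
  assumes "\<And>a a'. \<phi> (a + a') = \<phi> a + \<phi> a'" "\<And>c a. \<phi> (c *\<^sub>C a) = \<gamma> c *\<^sub>C \<phi> a"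
    and "\<And>b b'. \<psi> (b + b') = \<psi> b + \<psi> b'" "\<And>c b. \<psi> (c *\<^sub>C b) = \<gamma> c *\<^sub>C \<psi> b"
    and "tensor_eq M N"
  shows "tensor_eq (image_mset (map_prod \<phi> \<psi>) M) (image_mset (map_prod \<phi> \<psi>) N)"
  using assms(5)
proof induction
  case (zero b)
  have "\<phi> 0 + \<phi> 0 = \<phi> 0 + 0"
    using assms(1)[of 0 0] by simp
  then have "\<phi> 0 = 0"
    by (rule add_left_imp_eq)
  then show ?case
    by (simp add: tensor_eq.zero)
qed (auto simp: assms(1-4) intro: tensor_eq.intros)

instantiation tensor :: (complex_vector, complex_vector) complex_vector
begin

lift_definition zero_tensor :: "('a, 'b) tensor" is "{#}" .

lift_definition plus_tensor :: "('a, 'b) tensor \<Rightarrow> ('a, 'b) tensor \<Rightarrow> ('a, 'b) tensor"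
  is "(+)" by (rule tensor_eq.cong)

lift_definition scaleC_tensor :: "complex \<Rightarrow> ('a, 'b) tensor \<Rightarrow> ('a, 'b) tensor"
  is "\<lambda>c. image_mset (map_prod (scaleC c) id)"
  by (rule tensor_eq_map[where \<gamma> = id])
    (simp_all add: scaleC_add_right scaleC_scaleC mult.commute)

lift_definition uminus_tensor :: "('a, 'b) tensor \<Rightarrow> ('a, 'b) tensor"
  is "image_mset (map_prod uminus id)"
  by (rule tensor_eq_map[where \<gamma> = id]) simp_all

definition minus_tensor :: "('a, 'b) tensor \<Rightarrow> ('a, 'b) tensor \<Rightarrow> ('a, 'b) tensor"
  where "minus_tensor x y = x + - y"

instance
proof
  fix x y z :: "('a, 'b) tensor" and c d :: complex
  show "x + y + z = x + (y + z)"
    by transfer (simp add: add.assoc tensor_eq.refl)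
  show "x + y = y + x"
    by transfer (simp add: add.commute tensor_eq.refl)
  show "0 + x = x"
    by transfer (simp add: tensor_eq.refl)
  show "x - y = x + - y"
    by (rule minus_tensor_def)
  show "- x + x = 0"
  proof transfer
    fix M :: "('a \<times> 'b) multiset"
    show "tensor_eq (image_mset (map_prod uminus id) M + M) {#}"
    proof (induction M)
      case (add p M)
      obtain a b where p: "p = (a, b)"
        by fastforce
      have "tensor_eq {#(- a, b), (a, b)#} {#}"
        using tensor_eq.sym[OF tensor_eq.add_left[of "- a" a b]] tensor_eq.zero
        by (auto intro: tensor_eq.trans)
      from tensor_eq.cong[OF this add.IH] show ?case
        by (simp add: p add_mset_commute)
    qed (simp add: tensor_eq.refl)
  qed
  show "c *\<^sub>C (x + y) = c *\<^sub>C x + c *\<^sub>C y"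
    by transfer (simp add: tensor_eq.refl)
  show "(c + d) *\<^sub>C x = c *\<^sub>C x + d *\<^sub>C x"
  proof transfer
    fix c d and M :: "('a \<times> 'b) multiset"
    show "tensor_eq (image_mset (map_prod (scaleC (c + d)) id) M)
      (image_mset (map_prod (scaleC c) id) M + image_mset (map_prod (scaleC d) id) M)"
    proof (induction M)
      case (add p M)
      obtain a b where p: "p = (a, b)"
        by fastforce
      from tensor_eq.cong[OF tensor_eq.add_left[of "c *\<^sub>C a" "d *\<^sub>C a" b] add.IH] show ?case
        by (simp add: p scaleC_add_left add_mset_commute)
    qed (simp add: tensor_eq.refl)
  qed
  show "c *\<^sub>C d *\<^sub>C x = (c * d) *\<^sub>C x"
    by transfer
      (simp add: multiset.map_comp o_def map_prod_def case_prod_unfold scaleC_scaleC tensor_eq.refl)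
  show "1 *\<^sub>C x = x"
    by transfer (simp add: map_prod_def case_prod_unfold scaleC_one tensor_eq.refl)
qed

end

lemma tensor_add_left: "(a + a') \<otimes>\<^sub>C b = a \<otimes>\<^sub>C b + a' \<otimes>\<^sub>C b"
  by transfer (simp add: tensor_eq.add_left add_mset_commute)

lemma tensor_add_right: "a \<otimes>\<^sub>C (b + b') = a \<otimes>\<^sub>C b + a \<otimes>\<^sub>C b'"
  by transfer (simp add: tensor_eq.add_right add_mset_commute)

lemma tensor_scaleC_left: "(c *\<^sub>C a) \<otimes>\<^sub>C b = c *\<^sub>C (a \<otimes>\<^sub>C b)"
  by transfer (simp add: tensor_eq.refl)

lemma tensor_scaleC_right: "a \<otimes>\<^sub>C (c *\<^sub>C b) = c *\<^sub>C (a \<otimes>\<^sub>C b)"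
  by transfer (simp add: tensor_eq.sym[OF tensor_eq.scale])

lemma tensor_induct [case_names zero add]:
  assumes "P 0" and "\<And>a b x. P x \<Longrightarrow> P (a \<otimes>\<^sub>C b + x)"
  shows "P x"
proof -
  have "P (abs_tensor M)" for M
  proof (induction M)
    case empty
    then show ?case
      using assms(1) by (simp add: zero_tensor_def)
  next
    case (add p M)
    obtain a b where p: "p = (a, b)"
      by fastforce
    have "abs_tensor (add_mset p M) = a \<otimes>\<^sub>C b + abs_tensor M"
      by (simp add: p pure_tensor.abs_eq plus_tensor.abs_eq)
    then show ?case
      using assms(2) add.IH by simp
  qed
  then show ?thesis
    by (metis Quotient_tensor Quotient_abs_rep)
qed

lemma clinear_tensor_eqI:
  assumes "clinear g" "clinear h" "\<And>a b. g (a \<otimes>\<^sub>C b) = h (a \<otimes>\<^sub>C b)"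
  shows "g = h"
proof
  interpret g: Vector_Spaces.linear scaleC scaleC g by fact
  interpret h: Vector_Spaces.linear scaleC scaleC h by fact
  show "g x = h x" for x
    by (induction x rule: tensor_induct) (simp_all add: g.zero h.zero g.add h.add assms(3))
qed

text \<open>The universal property.\<close>

lemma tensor_universal:
  fixes \<beta> :: "'a::complex_vector \<Rightarrow> 'b::complex_vector \<Rightarrow> 'c::complex_vector"
  assumes "\<And>b. clinear (\<lambda>a. \<beta> a b)" "\<And>a. clinear (\<beta> a)"
  shows "\<exists>!g. clinear g \<and> (\<forall>a b. g (a \<otimes>\<^sub>C b) = \<beta> a b)"
proof (rule ex_ex1I)
  define s where "s M = (\<Sum>(a, b)\<in>#M. \<beta> a b)" for M
  interpret l: Vector_Spaces.linear scaleC scaleC "\<lambda>a. \<beta> a b" for b by (rule assms(1))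
  interpret r: Vector_Spaces.linear scaleC scaleC "\<beta> a" for a by (rule assms(2))
  have s: "s M = s N" if "tensor_eq M N" for M N
    using that
    by induction (simp_all add: s_def l.zero l.add r.add l.scale r.scale)
  have s': "s (rep_tensor (abs_tensor M)) = s M" for M
    by (rule s) (metis Quotient_rep_abs Quotient_tensor tensor_eq.refl)
  have pure: "s (rep_tensor (a \<otimes>\<^sub>C b)) = \<beta> a b" for a b
    by (simp add: pure_tensor.abs_eq s') (simp add: s_def)
  have zero: "s (rep_tensor 0) = 0"
    by (simp add: zero_tensor_def s') (simp add: s_def)
  have add: "s (rep_tensor (x + y)) = s (rep_tensor x) + s (rep_tensor y)" for x y
  proof -
    have "x + y = abs_tensor (rep_tensor x + rep_tensor y)"
      by (metis Quotient_abs_rep Quotient_tensor plus_tensor.abs_eq)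
    then show ?thesis
      by (simp add: s') (simp add: s_def)
  qed
  have scale: "s (rep_tensor (c *\<^sub>C x)) = c *\<^sub>C s (rep_tensor x)" for c x
    by (induction x rule: tensor_induct)
      (simp_all add: zero add pure scaleC_add_right tensor_scaleC_left[symmetric] l.scale)
  have "clinear (\<lambda>x. s (rep_tensor x))"
    by (intro Vector_Spaces.linear.intro module_hom.intro module_hom_axioms.intro
        complex_vector.vector_space_axioms complex_vector.module_axioms add scale)
  with pure show "\<exists>g. clinear g \<and> (\<forall>a b. g (a \<otimes>\<^sub>C b) = \<beta> a b)"
    by blast
qed (auto intro: clinear_tensor_eqI)

instantiation tensor :: (unital_star_algebra, unital_star_algebra) unital_star_algebra
begin

lift_definition one_tensor :: "('a, 'b) tensor" is "{#(1, 1)#}" .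

lift_definition times_tensor :: "('a, 'b) tensor \<Rightarrow> ('a, 'b) tensor \<Rightarrow> ('a, 'b) tensor"
  is "\<lambda>M N. \<Sum>(a, b)\<in>#M. \<Sum>(a', b')\<in>#N. {#(a * a', b * b')#}"
proof -
  define m where "m M N = (\<Sum>(a, b)\<in>#M. \<Sum>(a', b')\<in>#N. {#(a * a', b * b')#})"
    for M N :: "('a \<times> 'b) multiset"
  have sum_cong: "tensor_eq (\<Sum>p\<in>#P. F p) (\<Sum>p\<in>#P. G p)"
    if "\<And>p. tensor_eq (F p) (G p)"
    for P :: "('a \<times> 'b) multiset" and F G :: "'a \<times> 'b \<Rightarrow> ('a \<times> 'b) multiset"
    using that by (induction P) (auto intro: tensor_eq.refl tensor_eq.cong)
  have m1: "m M N = (\<Sum>p\<in>#M. image_mset (map_prod ((*) (fst p)) ((*) (snd p))) N)" for M N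
    by (simp add: m_def case_prod_unfold map_prod_def)
  have m2: "m M N = (\<Sum>q\<in>#N. image_mset (map_prod (\<lambda>a. a * fst q) (\<lambda>b. b * snd q)) M)" for M N
    unfolding m_def case_prod_unfold
    by (subst sum_mset.swap) (simp add: case_prod_unfold map_prod_def)
  have "tensor_eq (m M N) (m M N')" if "tensor_eq N N'" for M N N'
    unfolding m1 using that
    by (intro sum_cong tensor_eq_map[where \<gamma> = id]) (simp_all add: distrib_left mult_scaleC_right)
  moreover have "tensor_eq (m M N) (m M' N)" if "tensor_eq M M'" for M M' N
    unfolding m2 using that
    by (intro sum_cong tensor_eq_map[where \<gamma> = id]) (simp_all add: distrib_right mult_scaleC_left)
  ultimately show "tensor_eq (\<Sum>(a, b)\<in>#M. \<Sum>(a', b')\<in>#N. {#(a * a', b * b')#})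
      (\<Sum>(a, b)\<in>#M'. \<Sum>(a', b')\<in>#N'. {#(a * a', b * b')#})"
    if "tensor_eq M M'" "tensor_eq N N'" for M M' N N' :: "('a \<times> 'b) multiset"
    unfolding m_def[symmetric] using that by (blast intro: tensor_eq.trans)
qed

lift_definition star_tensor :: "('a, 'b) tensor \<Rightarrow> ('a, 'b) tensor"
  is "image_mset (map_prod star star)"
  by (rule tensor_eq_map[where \<gamma> = cnj]) (simp_all add: star_add star_scaleC)

lemma tensor_mult_pure: "(a \<otimes>\<^sub>C b) * (a' \<otimes>\<^sub>C b') = (a * a') \<otimes>\<^sub>C (b * b')"
  by transfer (simp add: tensor_eq.refl)

lemma tensor_star_pure: "star (a \<otimes>\<^sub>C b) = star a \<otimes>\<^sub>C star b"
  by transfer (simp add: tensor_eq.refl)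

lemma tensor_one: "1 = 1 \<otimes>\<^sub>C 1"
  by transfer (simp add: tensor_eq.refl)

instance
proof
  fix x y z :: "('a, 'b) tensor" and c :: complex
  have distl: "x * (y + z) = x * y + x * z" for x y z :: "('a, 'b) tensor"
    by transfer (simp add: case_prod_unfold sum_mset.distrib tensor_eq.refl del: sum_mset_singleton_mset)
  have distr: "(x + y) * z = x * z + y * z" for x y z :: "('a, 'b) tensor"
    by transfer (simp add: tensor_eq.refl)
  show "(x + y) * z = x * z + y * z"
    by (rule distr)
  show "x * (y + z) = x * y + x * z"
    by (rule distl)
  have zl: "0 * x = 0" for x :: "('a, 'b) tensor"
    using distr[of 0 0 x] by simp
  have zr: "x * 0 = 0" for x :: "('a, 'b) tensor"
    using distl[of x 0 0] by simp
  have star_add: "star (x + y) = star x + star y" for x y :: "('a, 'b) tensor"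
    by transfer (simp add: tensor_eq.refl)
  have star_zero: "star (0 :: ('a, 'b) tensor) = 0"
    using star_add[of 0 0] by simp
  note simps = zl zr distl distr star_add star_zero scaleC_add_right tensor_mult_pure
    tensor_star_pure tensor_one
  have assoc1: "(a \<otimes>\<^sub>C b) * (a' \<otimes>\<^sub>C b') * z = (a \<otimes>\<^sub>C b) * ((a' \<otimes>\<^sub>C b') * z)"
    for a a' :: 'a and b b' :: 'b and z
    by (induction z rule: tensor_induct) (simp_all add: simps mult.assoc)
  have assoc2: "(a \<otimes>\<^sub>C b) * y * z = (a \<otimes>\<^sub>C b) * (y * z)" for a :: 'a and b :: 'b and y z
    by (induction y rule: tensor_induct)
      (simp_all add: zl zr distl distr assoc1)
  show "x * y * z = x * (y * z)"
    by (induction x rule: tensor_induct) (simp_all add: zl zr distl distr assoc2)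
  show "1 * x = x"
    by (induction x rule: tensor_induct) (simp_all add: simps)
  show "x * 1 = x"
    by (induction x rule: tensor_induct) (simp_all add: simps)
  have sc1: "(c *\<^sub>C (a \<otimes>\<^sub>C b)) * y = c *\<^sub>C ((a \<otimes>\<^sub>C b) * y)" for a :: 'a and b :: 'b and y
    by (induction y rule: tensor_induct)
      (simp_all add: simps mult_scaleC_left flip: tensor_scaleC_left)
  show "(c *\<^sub>C x) * y = c *\<^sub>C (x * y)"
    by (induction x rule: tensor_induct) (simp_all add: zl distr scaleC_add_right sc1)
  have sc2: "x * (c *\<^sub>C (a \<otimes>\<^sub>C b)) = c *\<^sub>C (x * (a \<otimes>\<^sub>C b))" for a :: 'a and b :: 'b and x
    by (induction x rule: tensor_induct)
      (simp_all add: simps mult_scaleC_right flip: tensor_scaleC_left)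
  show "x * (c *\<^sub>C y) = c *\<^sub>C (x * y)"
    by (induction y rule: tensor_induct) (simp_all add: zr distl scaleC_add_right sc2)
  show "star (x + y) = star x + star y"
    by (rule star_add)
  show "star (c *\<^sub>C x) = cnj c *\<^sub>C star x"
    by (induction x rule: tensor_induct)
      (simp_all add: simps star_scaleC flip: tensor_scaleC_left)
  have sm: "star ((a \<otimes>\<^sub>C b) * y) = star y * star (a \<otimes>\<^sub>C b)" for a :: 'a and b :: 'b and y
    by (induction y rule: tensor_induct) (simp_all add: simps star_mult)
  show "star (x * y) = star y * star x"
    by (induction x rule: tensor_induct) (simp_all add: zl zr distl distr star_add star_zero sm)
  show "star (star x) = x"
    by (induction x rule: tensor_induct) (simp_all add: simps star_star)
qed

end


section \<open>Positivity, effects and square roots\<close>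

text \<open>
  These notions depend only on the *-algebra structure, so they apply to the tensor product of two
  finite-dimensional C*-algebras without mentioning its (unique) C*-norm.
\<close>

definition star_positive :: "'a::unital_star_algebra \<Rightarrow> bool"
  where "star_positive a \<longleftrightarrow> (\<exists>x. a = star x * x)"

definition star_le :: "'a::unital_star_algebra \<Rightarrow> 'a \<Rightarrow> bool"
  where "star_le a b \<longleftrightarrow> star_positive (b - a)"

definition star_effects :: "'a::unital_star_algebra set"
  where "star_effects = {a. star_le 0 a \<and> star_le a 1}"

definition star_center :: "'a::unital_star_algebra set"
  where "star_center = {a. \<forall>b. a * b = b * a}"

definition star_sqrt :: "'a::unital_star_algebra \<Rightarrow> 'a"
  where "star_sqrt a = (THE s. star_positive s \<and> s * s = a)"

definition star_invertible :: "'a::unital_star_algebra \<Rightarrow> bool"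
  where "star_invertible a \<longleftrightarrow> (\<exists>b. a * b = 1 \<and> b * a = 1)"

definition star_inverse :: "'a::unital_star_algebra \<Rightarrow> 'a"
  where "star_inverse a = (THE b. a * b = 1 \<and> b * a = 1)"

text \<open>
  A map into the center is treated as a map into the whole algebra with range in
  \<^const>\<open>star_center\<close>; positivity in a C*-subalgebra agrees with positivity in the algebra.
\<close>

definition positive_unital_map :: "('a::unital_star_algebra \<Rightarrow> 'b::unital_star_algebra) \<Rightarrow> bool"
  where "positive_unital_map f \<longleftrightarrow>
    clinear f \<and> (\<forall>a. star_positive a \<longrightarrow> star_positive (f a)) \<and> f 1 = 1"


section \<open>Characteristic, graph and joint maps\<close>

definition char_map :: "'a::unital_star_algebra \<Rightarrow> 'a \<times> 'a \<Rightarrow> 'a"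
  where "char_map e = (\<lambda>(a, a').
    star_sqrt e * a * star_sqrt e + star_sqrt (1 - e) * a' * star_sqrt (1 - e))"

definition graph_map ::
    "('b::unital_star_algebra \<Rightarrow> 'a::unital_star_algebra) \<Rightarrow> ('a, 'b) tensor \<Rightarrow> 'a"
  where "graph_map f = (THE g. clinear g \<and> (\<forall>a b. g (a \<otimes>\<^sub>C b) = a * f b))"

lemma graph_map:
  fixes f :: "'b::unital_star_algebra \<Rightarrow> 'a::unital_star_algebra"
  assumes "clinear f"
  shows "clinear (graph_map f)" and "graph_map f (a \<otimes>\<^sub>C b) = a * f b"
proof -
  interpret f: Vector_Spaces.linear scaleC scaleC f by fact
  have "clinear (\<lambda>a. a * f b)" "clinear (\<lambda>b. a * f b)" for a b
    by (unfold_locales;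
        simp add: distrib_left distrib_right mult_scaleC_left mult_scaleC_right f.add f.scale)+
  from theI'[OF tensor_universal[OF this], folded graph_map_def]
  show "clinear (graph_map f)" and "graph_map f (a \<otimes>\<^sub>C b) = a * f b"
    by blast+
qed

definition joint_map ::
    "('b::unital_star_algebra \<Rightarrow> 'a::unital_star_algebra) \<Rightarrow> ('a, 'b) tensor \<Rightarrow> 'b \<times> 'b \<Rightarrow> 'a"
  where "joint_map f e = graph_map f \<circ> char_map e \<circ> map_prod ((\<otimes>\<^sub>C) 1) ((\<otimes>\<^sub>C) 1)"

end

theory Submission
  imports Defs "HOL-Computational_Algebra.Fundamental_Theorem_Algebra"
begin

text \<open>
  The only property of the C*-norm that matters is that \<open>x\<^sup>* x = 0\<close> implies \<open>x = 0\<close>. In finite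
  dimension this suffices for the spectral theorem, with minimal projections as eigenprojections,
  and hence for positive square roots. An element is positive iff it is self-adjoint and its
  compression to every minimal projection is a nonnegative scalar.
  The tensor product inherits the property: for a faithful positive functional \<open>\<omega>\<close> on \<open>B\<close>, a
  Gram-Schmidt argument turns \<open>(id \<otimes> \<omega>) (x\<^sup>* x)\<close> into a sum of squares in \<open>A\<close> that vanishes only
  for \<open>x = 0\<close>. Compressed to a minimal projection of \<open>A\<close>, the graph map of a map into the center is
  such a slice map, so it is positive. The two conditional maps are then forced to be
  \<open>s\<^sup>-\<^sup>1 (f \<and> e) s\<^sup>-\<^sup>1\<close> with \<open>s\<close> the respective square root, and these are positive and unital.
\<close>

section \<open>Finite-dimensional *-algebras with proper involution\<close>

text \<open>Both properties pass to the tensor product, which carries no norm here, so the spectral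
  theory below applies to elements of \<open>('a, 'b) tensor\<close> as well.\<close>

class proper_star_algebra = unital_star_algebra +
  assumes finite_spanning: "\<exists>S. finite S \<and> (\<forall>x. \<exists>c. x = (\<Sum>s\<in>S. c s *\<^sub>C s))"
    and proper: "star x * x = 0 \<Longrightarrow> x = 0"

instance fd_cstar_algebra \<subseteq> proper_star_algebra
proof
  fix x :: 'a
  assume "star x * x = 0"
  then have "norm x ^ 2 = 0"
    by (metis cstar_identity norm_zero)
  then show "x = 0"
    by simp
qed (rule finite_dim)

section \<open>Calculation rules for the involution and for linear maps\<close>

lemma star_zero [simp]: "star 0 = (0::'a::unital_star_algebra)"
  using star_add[of 0 "0::'a"] by simp

lemma star_one [simp]: "star 1 = (1::'a::unital_star_algebra)"
  by (metis mult.right_neutral mult.left_neutral star_mult star_star)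

lemma star_uminus: "star (- x) = - star (x::'a::unital_star_algebra)"
  using star_add[of x "- x"] by (simp add: eq_neg_iff_add_eq_0 add.commute)

lemma star_diff: "star (x - y) = star x - star (y::'a::unital_star_algebra)"
  using star_add[of x "- y"] by (simp add: star_uminus)

lemma star_sum: "star (\<Sum>i\<in>I. g i) = (\<Sum>i\<in>I. star (g i :: 'a::unital_star_algebra))"
  by (induction I rule: infinite_finite_induct) (simp_all add: star_add)

lemma clinearI:
  fixes f :: "'a::complex_vector \<Rightarrow> 'b::complex_vector"
  assumes "\<And>x y. f (x + y) = f x + f y" "\<And>c x. f (c *\<^sub>C x) = c *\<^sub>C f x"
  shows "clinear f"
  by (intro Vector_Spaces.linear.intro module_hom.intro module_hom_axioms.intro
      complex_vector.vector_space_axioms complex_vector.module_axioms assms)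

lemma clinear_simps:
  assumes "clinear f"
  shows "f (x + y) = f x + f y" "f (c *\<^sub>C x) = c *\<^sub>C f x" "f 0 = 0" "f (x - y) = f x - f y"
proof -
  interpret Vector_Spaces.linear scaleC scaleC f by fact
  show "f (x + y) = f x + f y" "f (c *\<^sub>C x) = c *\<^sub>C f x" "f 0 = 0" "f (x - y) = f x - f y"
    by (simp_all add: add scale zero diff)
qed

lemma star_scaleC_mult_scaleC:
  fixes x :: "'a::unital_star_algebra"
  shows "star (c *\<^sub>C x) * (d *\<^sub>C y) = (cnj c * d) *\<^sub>C (star x * y)"
  by (simp add: star_scaleC mult_scaleC_left mult_scaleC_right scaleC_scaleC)

text \<open>Real and imaginary part: \<open>u = (x + star x) / 2\<close> and
  \<open>v = (x - star x) / (2 * \<i>)\<close>.\<close>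

lemma ex_selfadjoint_decomposition:
  fixes x :: "'a::unital_star_algebra"
  obtains u v where "star u = u" "star v = v" "x = u + \<i> *\<^sub>C v"
proof
  show "star ((1 / 2) *\<^sub>C (x + star x)) = (1 / 2) *\<^sub>C (x + star x)"
    by (simp add: star_scaleC star_add star_star add.commute)
  show "star ((- \<i> / 2) *\<^sub>C (x - star x)) = (- \<i> / 2) *\<^sub>C (x - star x)"
    by (simp add: star_scaleC star_diff star_star complex_vector.scale_right_diff_distrib
        complex_vector.scale_minus_left)
  have "(1 / 2) *\<^sub>C x + (1 / 2) *\<^sub>C x = x"
    by (simp flip: scaleC_add_left)
  then show "x = (1 / 2) *\<^sub>C (x + star x) + \<i> *\<^sub>C (- \<i> / 2) *\<^sub>C (x - star x)"
    by (simp add: scaleC_scaleC scaleC_add_right complex_vector.scale_right_diff_distrib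
        scaleC_add_left)
qed

section \<open>Polynomials in an element and eigenprojections\<close>

text \<open>Horner evaluation of a complex polynomial at an algebra element, with constants embedded
  as multiples of the unit.\<close>

definition peval :: "'a::unital_star_algebra \<Rightarrow> complex poly \<Rightarrow> 'a"
  where "peval h p = fold_coeffs (\<lambda>c x. c *\<^sub>C 1 + h * x) p 0"

lemma peval_0 [simp]: "peval h 0 = 0"
  by (simp add: peval_def)

lemma peval_pCons [simp]: "peval h (pCons c p) = c *\<^sub>C 1 + h * peval h p"
  by (cases "p = 0 \<and> c = 0") (auto simp: peval_def)

lemma peval_add: "peval h (p + q) = peval h p + peval h q"
  by (induction p q rule: poly_induct2) (simp_all add: scaleC_add_left algebra_simps)

lemma peval_smult: "peval h (smult c p) = c *\<^sub>C peval h p"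
  by (induction p) (simp_all add: scaleC_add_right scaleC_scaleC mult_scaleC_right)

lemma peval_mult: "peval h (p * q) = peval h p * peval h q"
  by (induction p)
    (simp_all add: peval_add peval_smult distrib_right mult_scaleC_left mult.assoc)

lemma peval_monom: "peval h (monom c n) = c *\<^sub>C h ^ n"
  by (induction n) (simp_all add: monom_0 monom_Suc mult_scaleC_right)

lemma peval_sum: "peval h (\<Sum>i\<in>I. p i) = (\<Sum>i\<in>I. peval h (p i))"
  by (induction I rule: infinite_finite_induct) (simp_all add: peval_add)

lemma peval_commute:
  assumes "x * h = h * x"
  shows "x * peval h p = peval h p * x"
proof (induction p)
  case (pCons c p)
  have "x * (h * peval h p) = h * (x * peval h p)"
    by (simp add: assms mult.assoc[symmetric])
  then show ?case
    by (simp add: pCons.IH algebra_simps mult_scaleC_left mult_scaleC_right)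
qed simp

lemma star_peval:
  assumes "star h = h"
  shows "star (peval h p) = peval h (map_poly cnj p)"
proof (induction p)
  case (pCons c p)
  have "peval h (map_poly cnj p) * h = h * peval h (map_poly cnj p)"
    by (rule peval_commute[symmetric]) simp
  then show ?case
    using pCons by (simp add: map_poly_pCons star_add star_scaleC star_mult assms)
qed simp

text \<open>Here \<open>y\<close> serves as an eigenvector of left multiplication by
  \<open>h\<close>, on which a polynomial in \<open>h\<close> acts through its value at the
  eigenvalue.\<close>

lemma peval_eigen:
  assumes "h * y = c *\<^sub>C y"
  shows "peval h p * y = poly p c *\<^sub>C y"
  by (induction p)
    (simp_all add: distrib_right mult_scaleC_left mult_scaleC_right mult.assoc assms scaleC_add_left
      scaleC_scaleC mult.commute)

lemma ex_finite_span: "\<exists>S::'a::proper_star_algebra set. finite S \<and> complex_vector.span S = UNIV"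
proof -
  obtain S :: "'a set" where S: "finite S" "\<forall>x. \<exists>c. x = (\<Sum>s\<in>S. c s *\<^sub>C s)"
    using finite_spanning by blast
  have "complex_vector.span S = UNIV"
    unfolding complex_vector.span_finite[OF S(1)] using S(2) by (simp add: surj_def)
  with S(1) show ?thesis
    by blast
qed

text \<open>Finite dimension forces a nontrivial linear relation among the powers of
  \<open>h\<close>.\<close>

lemma ex_annihilating_poly:
  fixes h :: "'a::proper_star_algebra"
  shows "\<exists>p. p \<noteq> 0 \<and> peval h p = 0"
proof -
  obtain S :: "'a set" where S: "finite S" "range ((^) h) \<subseteq> complex_vector.span S"
    using ex_finite_span by (metis subset_UNIV)
  show ?thesis
  \<comment> \<open>If powers repeat, the set of powers can be finite and independent; a difference
    of two monomials then does the job.\<close>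
  proof (cases "inj ((^) h)")
    case False
    then obtain i j where ij: "i \<noteq> j" "h ^ i = h ^ j"
      by (auto simp: inj_def)
    let ?p = "monom 1 i + monom (- 1) j :: complex poly"
    have "coeff ?p i = 1"
      using ij by simp
    then have "?p \<noteq> 0"
      by fastforce
    moreover have "peval h ?p = 0"
      using ij by (simp add: peval_add peval_monom complex_vector.scale_minus_left scaleC_one)
    ultimately show ?thesis
      by blast
  next
    case True
    then have "infinite (range ((^) h))"
      by (simp add: finite_image_iff)
    then have "complex_vector.dependent (range ((^) h))"
      using complex_vector.independent_span_bound[OF S(1) _ S(2)] by blast
    then obtain T u where T: "finite T" "T \<subseteq> range ((^) h)" "(\<Sum>v\<in>T. u v *\<^sub>C v) = 0"
      "\<exists>v\<in>T. u v \<noteq> 0"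
      unfolding complex_vector.dependent_explicit by blast
    obtain I where I: "T = (^) h ` I" "inj_on ((^) h) I"
      using T(2) True by (metis inj_on_subset subset_UNIV subset_imageE)
    have fin: "finite I"
      using T(1) I by (simp add: finite_image_iff)
    let ?p = "\<Sum>i\<in>I. monom (u (h ^ i)) i"
    obtain i where i: "i \<in> I" "u (h ^ i) \<noteq> 0"
      using T(4) I by auto
    have "coeff ?p i = u (h ^ i)"
      using fin i by (simp add: coeff_sum sum.delta)
    then have "?p \<noteq> 0"
      using i by fastforce
    moreover have "peval h ?p = 0"
      using T(3) I by (simp add: peval_sum peval_monom sum.reindex)
    ultimately show ?thesis
      by blast
  qed
qed

section \<open>Projections and orthogonal families\<close>

definition projection :: "'a::unital_star_algebra \<Rightarrow> bool"
  where "projection p \<longleftrightarrow> star p = p \<and> p * p = p"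

text \<open>
  If \<open>(t - c) n\<close> is a polynomial of least degree that annihilates \<open>h\<close> on the corner of \<open>e\<close>, then
  \<open>n(h) e\<close> is a scalar multiple of the required projection.
\<close>

lemma ex_eigenprojection:
  fixes h e :: "'a::proper_star_algebra"
  assumes h: "star h = h" and e: "projection e" "e \<noteq> 0" "h * e = e * h"
  obtains q r where "projection q" "q \<noteq> 0" "h * q = complex_of_real r *\<^sub>C q" "e * q = q"
proof -
  define P where "P p \<longleftrightarrow> p \<noteq> 0 \<and> peval h p * e = 0" for p
  have "\<exists>p. P p"
    using ex_annihilating_poly[of h] by (auto simp: P_def)
  then obtain p where p: "P p" and min: "\<And>p'. P p' \<Longrightarrow> degree p \<le> degree p'"
    using ex_has_least_nat[of P _ degree] by blast
  have "degree p \<noteq> 0"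
  proof
    assume "degree p = 0"
    then obtain c where "p = [:c:]"
      by (rule degree_eq_zeroE)
    with p e(2) show False
      by (simp add: P_def mult_scaleC_left)
  qed
  then obtain c where "poly p c = 0"
    using fundamental_theorem_of_algebra[of p] by (auto simp: constant_degree)
  then obtain n where n: "p = [:- c, 1:] * n"
    by (auto simp: poly_eq_0_iff_dvd elim: dvdE)
  define y where "y = peval h n * e"
  have "n \<noteq> 0"
    using p n by (auto simp: P_def)
  then have "degree n < degree p"
    unfolding n by (subst degree_mult_eq) auto
  then have y0: "y \<noteq> 0"
    using min[of n] \<open>n \<noteq> 0\<close> by (auto simp: P_def y_def)
  have ev: "h * y = c *\<^sub>C y"
  proof -
    have "(h - c *\<^sub>C 1) * y = 0"
      using p unfolding P_def n peval_mult y_def by (simp add: mult.assoc algebra_simps)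
    then show ?thesis
      by (simp add: left_diff_distrib mult_scaleC_left)
  qed
  have ee: "star e = e" "e * e = e"
    using e(1) by (simp_all add: projection_def)
  have comm: "e * peval h n = peval h n * e"
    by (rule peval_commute) (simp add: e(3))
  have ey: "e * y = y"
    by (simp add: y_def comm mult.assoc[symmetric]) (simp add: mult.assoc ee)
  \<comment> \<open>This element is self-adjoint and equals \<open>c\<close> times the nonzero
    self-adjoint \<open>star y * y\<close>, so \<open>c\<close> is real.\<close>
  have "star y * (h * y) = star (star y * (h * y))"
    by (simp add: star_mult star_star h mult.assoc)
  then have "c *\<^sub>C (star y * y) = cnj c *\<^sub>C (star y * y)"
    by (simp add: ev mult_scaleC_right star_mult star_scaleC star_star)
  then have "c = cnj c"
    using y0 proper[of y] by (metis complex_vector.scale_cancel_right)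
  then obtain r where r: "c = complex_of_real r"
    by (metis Reals_cnj_iff Reals_cases)
  define d where "d = poly n c"
  \<comment> \<open>Up to the factor \<open>e\<close>, \<open>star y\<close> is again a polynomial
    in \<open>h\<close>, with conjugated coefficients, so it acts on the eigenvector
    \<open>y\<close> as a scalar.\<close>
  have yy: "star y * y = poly (map_poly cnj n) c *\<^sub>C y"
  proof -
    have "star y = e * peval h (map_poly cnj n)"
      by (simp add: y_def star_mult star_peval h ee)
    then show ?thesis
      by (simp add: mult.assoc peval_eigen[OF ev] mult_scaleC_right ey)
  qed
  have cd: "poly (map_poly cnj n) c = cnj d"
    using r by (simp add: d_def)
  have d0: "d \<noteq> 0"
    using yy cd y0 proper[of y] by auto
  have yy': "y * y = d *\<^sub>C y"
    using peval_eigen[OF ev, of n] ey by (simp add: y_def d_def mult.assoc)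
  \<comment> \<open>The factor makes \<open>y\<close> idempotent because
    \<open>y * y = d *\<^sub>C y\<close>. It is also self-adjoint, since \<open>star y * y\<close>
    is a nonzero real multiple of \<open>q\<close>.\<close>
  define q where "q = (1 / d) *\<^sub>C y"
  have "star y * y = (cnj d * d) *\<^sub>C q"
    using yy cd d0 by (simp add: q_def scaleC_scaleC)
  moreover have "star (star y * y) = star y * y"
    by (simp add: star_mult star_star)
  ultimately have "(cnj d * d) *\<^sub>C star q = (cnj d * d) *\<^sub>C q"
    by (metis star_scaleC complex_cnj_cnj complex_cnj_mult mult.commute)
  then have "star q = q"
    using d0 by (metis complex_vector.scale_cancel_left complex_cnj_zero_iff mult_eq_0_iff)
  moreover have "q * q = q"
    using d0 by (simp add: q_def mult_scaleC_left mult_scaleC_right scaleC_scaleC yy')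
  moreover have "q \<noteq> 0"
    using d0 y0 by (simp add: q_def)
  moreover have "h * q = complex_of_real r *\<^sub>C q"
    using ev r by (simp add: q_def mult_scaleC_right scaleC_scaleC mult.commute)
  moreover have "e * q = q"
    using ey by (simp add: q_def mult_scaleC_right)
  ultimately show thesis
    using that by (auto simp: projection_def)
qed

lemma projection_diff:
  assumes "projection p" "projection q" "p * q = q"
  shows "projection (p - q)" "q * (p - q) = 0"
proof -
  have "q * p = q"
    using assms by (metis projection_def star_mult)
  then show "projection (p - q)" "q * (p - q) = 0"
    using assms by (simp_all add: projection_def star_diff algebra_simps)
qed

text \<open>Orthogonal nonzero projections are linearly independent: multiplying a vanishing
  combination by \<open>p\<close> isolates the coefficient of \<open>p\<close>.\<close>

lemma card_orthogonal_le:
  fixes E S :: "'a::unital_star_algebra set"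
  assumes "finite S" "complex_vector.span S = UNIV"
    and proj: "\<And>p. p \<in> E \<Longrightarrow> projection p \<and> p \<noteq> 0"
    and orth: "\<And>p q. p \<in> E \<Longrightarrow> q \<in> E \<Longrightarrow> p \<noteq> q \<Longrightarrow> p * q = 0"
  shows "finite E \<and> card E \<le> card S"
proof (rule complex_vector.independent_span_bound[OF assms(1)])
  show "complex_vector.independent E"
    unfolding complex_vector.independent_explicit_module
  proof (intro allI impI)
    fix T u p
    assume T: "finite T" "T \<subseteq> E" "(\<Sum>v\<in>T. u v *\<^sub>C v) = 0" "p \<in> T"
    have "u q *\<^sub>C (p * q) = (if q = p then u p *\<^sub>C p else 0)" if "q \<in> T" for q
      using that T orth[of p q] proj[of p] by (auto simp: projection_def)
    then have "p * (\<Sum>v\<in>T. u v *\<^sub>C v) = u p *\<^sub>C p"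
      using T(1,4) by (simp add: sum_distrib_left mult_scaleC_right)
    then show "u p = 0"
      using T proj[of p] by auto
  qed
qed (simp add: assms(2))

definition orthogonal_projections :: "'a::unital_star_algebra set \<Rightarrow> bool"
  where "orthogonal_projections E \<longleftrightarrow> finite E \<and> (\<forall>p\<in>E. projection p \<and> p \<noteq> 0) \<and>
    (\<forall>p\<in>E. \<forall>q\<in>E. p \<noteq> q \<longrightarrow> p * q = 0)"

lemma orthogonal_projections_sum_mult:
  assumes "orthogonal_projections E" "p \<in> E"
  shows "\<Sum>E * p = p" "p * \<Sum>E = p"
proof -
  have "q * p = (if q = p then p else 0)" "p * q = (if q = p then p else 0)" if "q \<in> E" for q
    using assms that by (auto simp: orthogonal_projections_def projection_def)
  then show "\<Sum>E * p = p" "p * \<Sum>E = p"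
    using assms by (simp_all add: sum_distrib_left sum_distrib_right orthogonal_projections_def)
qed

lemma projection_sum:
  assumes "orthogonal_projections E"
  shows "projection (\<Sum>E)"
proof -
  have "\<Sum>E * \<Sum>E = (\<Sum>p\<in>E. \<Sum>E * p)"
    by (simp add: sum_distrib_left)
  also have "\<dots> = \<Sum>E"
    using orthogonal_projections_sum_mult(1)[OF assms] by simp
  finally show ?thesis
    using assms by (simp add: projection_def orthogonal_projections_def star_sum)
qed

text \<open>A family of largest cardinality in the commutant of \<open>h\<close> cannot be refined any further.\<close>

lemma ex_finest_resolution:
  fixes h :: "'a::proper_star_algebra"
  obtains E where "orthogonal_projections E" "\<Sum>E = 1"
    "\<And>p q. p \<in> E \<Longrightarrow> projection q \<Longrightarrow> q \<noteq> 0 \<Longrightarrow> p * q = q \<Longrightarrow> h * q = q * h \<Longrightarrow> q = p"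
    "\<And>p. p \<in> E \<Longrightarrow> h * p = p * h"
proof -
  define comm where "comm p \<longleftrightarrow> h * p = p * h" for p
  define P where "P E \<longleftrightarrow> orthogonal_projections E \<and> (\<forall>p\<in>E. comm p)" for E
  obtain S :: "'a set" where S: "finite S" "complex_vector.span S = UNIV"
    using ex_finite_span by blast
  have "card E \<le> card S" if "P E" for E
    using that card_orthogonal_le[OF S, of E] by (auto simp: P_def orthogonal_projections_def)
  moreover have "P {}"
    by (simp add: P_def orthogonal_projections_def)
  ultimately obtain E where E: "P E" and max: "\<And>F. P F \<Longrightarrow> card F \<le> card E"
    using ex_has_greatest_nat[of P "{}" card "Suc (card S)"] by (metis less_Suc_eq_le)
  have orth: "orthogonal_projections E" and fin: "finite E"
    using E by (auto simp: P_def orthogonal_projections_def)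
  note proj = projection_sum[OF orth]
  have one: "\<Sum>E = 1"
  proof (rule ccontr)
    assume "\<Sum>E \<noteq> 1"
    \<comment> \<open>The complement is orthogonal to all members and commutes with
      \<open>h\<close>, so adding it would enlarge the family.\<close>
    define r where "r = 1 - \<Sum>E"
    have r: "projection r" "r \<noteq> 0"
      using projection_diff[of 1 "\<Sum>E"] proj \<open>\<Sum>E \<noteq> 1\<close> by (auto simp: r_def projection_def)
    have *: "p * r = 0" "r * p = 0" if "p \<in> E" for p
      using orthogonal_projections_sum_mult[OF orth that] by (simp_all add: r_def algebra_simps)
    then have "r \<notin> E"
      using r by (auto simp: projection_def)
    have "comm r"
      using E by (auto simp: P_def comm_def r_def algebra_simps sum_distrib_left sum_distrib_right
          intro!: sum.cong)
    then have "P (insert r E)"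
      using E r * by (auto simp: P_def orthogonal_projections_def)
    from max[OF this] show False
      using \<open>r \<notin> E\<close> fin by simp
  qed
  have min: "q = p" if p: "p \<in> E" and q: "projection q" "q \<noteq> 0" "p * q = q" "comm q" for p q
  proof (rule ccontr)
    assume "q \<noteq> p"
    have p': "projection p" "comm p"
      using E p by (auto simp: P_def orthogonal_projections_def)
    have qp: "q * p = q"
      using p' q by (metis projection_def star_mult)
    \<comment> \<open>Replacing \<open>p\<close> by its two orthogonal parts \<open>q\<close> and
      \<open>p - q\<close> would give a family with one more member.\<close>
    define r where "r = p - q"
    have r: "projection r" "q * r = 0" "r \<noteq> 0" "comm r" "r * q = 0"
      using projection_diff[OF p'(1) q(1,3)] \<open>q \<noteq> p\<close> p' q
      by (auto simp: r_def comm_def algebra_simps projection_def)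
    have *: "x * q = 0" "q * x = 0" "x * r = 0" "r * x = 0" if "x \<in> E - {p}" for x
    proof -
      have xp: "x * p = 0" "p * x = 0"
        using that E p by (auto simp: P_def orthogonal_projections_def)
      then show "x * q = 0" "q * x = 0"
        by (metis q(3) mult.assoc mult_zero_left) (metis qp xp(2) mult.assoc mult_zero_right)
      then show "x * r = 0" "r * x = 0"
        using xp by (simp_all add: r_def algebra_simps)
    qed
    have "q \<notin> E - {p}" "r \<notin> E - {p}" "r \<noteq> q"
      using *(1)[of q] *(3)[of r] q(1,2) r(1,2,3) unfolding projection_def by metis+
    then have "card (insert r (insert q (E - {p}))) = Suc (card E)"
      using fin by (simp add: card.remove[OF fin p])
    moreover have "P (insert r (insert q (E - {p})))"
    proof -
      have "x * y = 0"
        if "x \<in> insert r (insert q (E - {p}))" "y \<in> insert r (insert q (E - {p}))" "x \<noteq> y" for x y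
        using that * r(2,5) orth unfolding orthogonal_projections_def by blast
      moreover have "projection x \<and> x \<noteq> 0 \<and> comm x" if "x \<in> insert r (insert q (E - {p}))" for x
        using that E q(1,2,4) r(1,3,4) unfolding P_def orthogonal_projections_def by blast
      ultimately show ?thesis
        using fin unfolding P_def orthogonal_projections_def by blast
    qed
    ultimately show False
      using max by (metis Suc_n_not_le_n)
  qed
  show thesis
    using that[OF orth one] min E unfolding comm_def P_def by blast
qed

section \<open>Minimal projections, spectral decomposition and square roots\<close>

text \<open>Minimality is encoded as a one-dimensional corner, the form in which it yields scalars;
  \<open>minimal_projectionI\<close> derives it from minimality in the order of projections.\<close>

definition minimal_projection :: "'a::unital_star_algebra \<Rightarrow> bool"
  where "minimal_projection q \<longleftrightarrow> projection q \<and> q \<noteq> 0 \<and> (\<forall>a. \<exists>c. q * a * q = c *\<^sub>C q)"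

text \<open>A self-adjoint element of the corner has an eigenprojection below \<open>p\<close>,
  which must be \<open>p\<close> itself, so the element is a multiple of \<open>p\<close>. Real and
  imaginary parts give the general case.\<close>

lemma minimal_projectionI:
  fixes p :: "'a::proper_star_algebra"
  assumes p: "projection p" "p \<noteq> 0"
    and atom: "\<And>q. projection q \<Longrightarrow> q \<noteq> 0 \<Longrightarrow> p * q = q \<Longrightarrow> q = p"
  shows "minimal_projection p"
proof -
  have sa: "\<exists>c. p * a * p = c *\<^sub>C p" if "star a = a" for a
  proof -
    let ?h = "p * a * p"
    have "star ?h = ?h" "?h * p = p * ?h"
      using p(1) that by (simp_all add: projection_def star_mult mult.assoc)
        (simp add: mult.assoc[symmetric])
    with p obtain q r where "projection q" "q \<noteq> 0" "?h * q = complex_of_real r *\<^sub>C q" "p * q = q"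
      using ex_eigenprojection[of ?h p] by blast
    with atom have "?h * p = complex_of_real r *\<^sub>C p"
      by blast
    then show ?thesis
      using p(1) by (metis projection_def mult.assoc)
  qed
  have "\<exists>c. p * a * p = c *\<^sub>C p" for a
  proof -
    obtain u v where uv: "star u = u" "star v = v" "a = u + \<i> *\<^sub>C v"
      by (rule ex_selfadjoint_decomposition)
    obtain c d where "p * u * p = c *\<^sub>C p" "p * v * p = d *\<^sub>C p"
      using sa uv by blast
    then have "p * a * p = (c + \<i> * d) *\<^sub>C p"
      by (simp add: uv(3) distrib_left distrib_right mult_scaleC_left mult_scaleC_right
          scaleC_add_left scaleC_scaleC)
    then show ?thesis
      by blast
  qed
  then show ?thesis
    using p by (simp add: minimal_projection_def)
qed

text \<open>Take a finest resolution commuting with \<open>h\<close>. Each member contains an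
  eigenprojection of \<open>h\<close>, which commutes with \<open>h\<close> and therefore is the
  whole member. Every projection below a member is then an eigenprojection too, so the member is
  minimal in the whole algebra.\<close>

lemma spectral_decomposition:
  fixes h :: "'a::proper_star_algebra"
  assumes h: "star h = h"
  obtains E ev where "orthogonal_projections E" "\<Sum>E = 1" "\<And>p. p \<in> E \<Longrightarrow> minimal_projection p"
    "\<And>p. p \<in> E \<Longrightarrow> h * p = complex_of_real (ev p) *\<^sub>C p"
    "\<And>p. p \<in> E \<Longrightarrow> p * h = complex_of_real (ev p) *\<^sub>C p"
proof -
  obtain E where E: "orthogonal_projections E" "\<Sum>E = 1"
    "\<And>p q. p \<in> E \<Longrightarrow> projection q \<Longrightarrow> q \<noteq> 0 \<Longrightarrow> p * q = q \<Longrightarrow> h * q = q * h \<Longrightarrow> q = p"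
    "\<And>p. p \<in> E \<Longrightarrow> h * p = p * h"
    using ex_finest_resolution[of h] by blast
  have proj: "projection p" "p \<noteq> 0" if "p \<in> E" for p
    using that E(1) by (auto simp: orthogonal_projections_def)
  have eigen: "q * h = h * q" if "projection q" "h * q = complex_of_real r *\<^sub>C q" for q r
  proof -
    have "q * h = star (h * q)"
      using that(1) h by (simp add: star_mult projection_def)
    then show ?thesis
      using that by (simp add: star_scaleC projection_def)
  qed
  have "\<exists>r. h * p = complex_of_real r *\<^sub>C p" if p: "p \<in> E" for p
  proof -
    obtain q r where q: "projection q" "q \<noteq> 0" "h * q = complex_of_real r *\<^sub>C q" "p * q = q"
      using ex_eigenprojection[OF h proj[OF p] E(4)[OF p]] by blast
    then show ?thesis
      using E(3)[OF p q(1,2,4)] eigen by auto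
  qed
  then obtain ev where ev: "\<And>p. p \<in> E \<Longrightarrow> h * p = complex_of_real (ev p) *\<^sub>C p"
    by metis
  have "minimal_projection p" if p: "p \<in> E" for p
  proof (rule minimal_projectionI[OF proj[OF p]])
    fix q
    assume q: "projection q" "q \<noteq> 0" "p * q = q"
    have "h * q = complex_of_real (ev p) *\<^sub>C q"
      by (metis ev[OF p] mult.assoc mult_scaleC_left q(3))
    then show "q = p"
      using E(3)[OF p q] eigen[OF q(1)] by metis
  qed
  then show thesis
    using that E ev by metis
qed

text \<open>
  If the scalar were negative, then \<open>y q\<close>, corrected by its component in \<open>q\<close> and a real multiple of
  \<open>q\<close>, would be a nonzero \<open>w\<close> with \<open>w\<^sup>* w = 0\<close>.
\<close>

lemma minimal_projection_square:
  fixes q :: "'a::proper_star_algebra"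
  assumes q: "minimal_projection q"
  obtains r where "r \<ge> 0" "q * (star y * y) * q = complex_of_real r *\<^sub>C q"
proof -
  have qq: "star q = q" "q * q = q" "q \<noteq> 0"
    using q by (auto simp: minimal_projection_def projection_def)
  obtain c where c: "q * y * q = c *\<^sub>C q"
    using q by (auto simp: minimal_projection_def)
  obtain l where l: "q * (star y * y) * q = l *\<^sub>C q"
    using q by (auto simp: minimal_projection_def)
  have "star (q * (star y * y) * q) = q * (star y * y) * q"
    by (simp add: star_mult star_star qq mult.assoc)
  then have "cnj l *\<^sub>C q = l *\<^sub>C q"
    by (simp add: l star_scaleC qq)
  then have "cnj l = l"
    using qq by (metis complex_vector.scale_cancel_right)
  then obtain r where r: "l = complex_of_real r"
    by (metis Reals_cnj_iff Reals_cases)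
  have "r \<ge> 0"
  proof (rule ccontr)
    assume neg: "\<not> r \<ge> 0"
    \<comment> \<open>Chosen so that \<open>star v * v = - (s ^ 2) q\<close> for the part
      \<open>v\<close> of \<open>y * q\<close> orthogonal to \<open>q\<close>; adding
      \<open>s\<close> times \<open>q\<close> to \<open>v\<close> then cancels the square, as the
      cross terms vanish.\<close>
    define s where "s = sqrt ((cmod c)\<^sup>2 - r)"
    have "r < (cmod c)\<^sup>2"
      using neg zero_le_power2[of "cmod c"] by linarith
    then have s: "s > 0" "s ^ 2 = (cmod c)\<^sup>2 - r"
      by (simp_all add: s_def)
    define v where "v = y * q - c *\<^sub>C q"
    have qv: "q * v = 0"
      using c by (simp add: v_def right_diff_distrib mult_scaleC_right qq mult.assoc)
    have vq: "star v * q = 0"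
      using arg_cong[OF qv, of star] by (simp add: star_mult qq)
    have "star v * v = star v * (y * q) - c *\<^sub>C (star v * q)"
      by (simp add: v_def right_diff_distrib mult_scaleC_right)
    also have "\<dots> = q * star y * y * q - cnj c *\<^sub>C (q * y * q)"
      by (simp add: vq)
        (simp add: v_def star_diff star_mult star_scaleC qq mult_scaleC_left left_diff_distrib mult.assoc)
    also have "\<dots> = (complex_of_real r - cnj c * c) *\<^sub>C q"
      using l r by (simp add: c[unfolded mult.assoc] mult.assoc scaleC_scaleC complex_vector.scale_left_diff_distrib)
    also have "complex_of_real r - cnj c * c = - complex_of_real (s ^ 2)"
      by (simp add: s complex_norm_square mult.commute del: of_real_power)
    finally have vv: "star v * v = - complex_of_real (s ^ 2) *\<^sub>C q" .
    define w where "w = v + complex_of_real s *\<^sub>C q"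
    have "star w * w = star v * v + complex_of_real (s ^ 2) *\<^sub>C q"
      by (simp add: w_def star_add star_scaleC distrib_left distrib_right mult_scaleC_left qq
          mult_scaleC_right qv vq scaleC_scaleC power2_eq_square)
    also have "\<dots> = 0"
      by (simp add: vv)
    finally have "w = 0"
      by (rule proper)
    then have "q * w = 0"
      by simp
    then have "complex_of_real s *\<^sub>C q = 0"
      by (simp add: w_def distrib_left qv mult_scaleC_right qq)
    then show False
      using s qq by simp
  qed
  then show thesis
    using that l r by blast
qed

section \<open>Linear combinations of orthogonal projections\<close>

lemma orthogonal_projections_combination_mult:
  assumes "orthogonal_projections E"
  shows "(\<Sum>p\<in>E. c p *\<^sub>C p) * (\<Sum>p\<in>E. d p *\<^sub>C p) = (\<Sum>p\<in>E. (c p * d p) *\<^sub>C p)"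
proof -
  have "(\<Sum>q\<in>E. c p *\<^sub>C p * d q *\<^sub>C q) = (c p * d p) *\<^sub>C p" if "p \<in> E" for p
  proof -
    have "c p *\<^sub>C p * d q *\<^sub>C q = (if q = p then (c p * d p) *\<^sub>C p else 0)" if "q \<in> E" for q
      using assms \<open>p \<in> E\<close> that
      by (auto simp: orthogonal_projections_def projection_def mult_scaleC_left mult_scaleC_right)
    then show ?thesis
      using assms that by (simp add: orthogonal_projections_def)
  qed
  then show ?thesis
    by (simp add: sum_product)
qed

lemma star_orthogonal_projections_combination:
  assumes "orthogonal_projections E"
  shows "star (\<Sum>p\<in>E. complex_of_real (c p) *\<^sub>C p) = (\<Sum>p\<in>E. complex_of_real (c p) *\<^sub>C p)"
  using assms
  by (auto simp: star_sum star_scaleC orthogonal_projections_def projection_def intro!: sum.cong)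

lemma star_positive_square: "star_positive (star x * x)"
  by (auto simp: star_positive_def)

lemma star_positive_combination:
  assumes "orthogonal_projections E" "\<And>p. p \<in> E \<Longrightarrow> c p \<ge> 0"
  shows "star_positive (\<Sum>p\<in>E. complex_of_real (c p) *\<^sub>C p)"
proof -
  let ?x = "\<Sum>p\<in>E. complex_of_real (sqrt (c p)) *\<^sub>C p"
  have "star ?x * ?x = (\<Sum>p\<in>E. complex_of_real (c p) *\<^sub>C p)"
    using assms
    by (simp add: star_orthogonal_projections_combination orthogonal_projections_combination_mult
        flip: of_real_mult)
  then show ?thesis
    by (metis star_positive_def)
qed

lemma star_positive_selfadjoint: "star_positive a \<Longrightarrow> star a = a"
  by (auto simp: star_positive_def star_mult star_star)

lemma spectral_sum:
  assumes "\<Sum>E = (1::'a::unital_star_algebra)" "\<And>p. p \<in> E \<Longrightarrow> h * p = c p *\<^sub>C p"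
  shows "h = (\<Sum>p\<in>E. c p *\<^sub>C p)"
proof -
  have "h = h * \<Sum>E"
    using assms by simp
  also have "\<dots> = (\<Sum>p\<in>E. c p *\<^sub>C p)"
    using assms(2) by (simp add: sum_distrib_left)
  finally show ?thesis .
qed

text \<open>For the converse, testing on the spectral projections of \<open>h\<close> shows that its
  eigenvalues are nonnegative. The criterion is additive in \<open>h\<close>, which the definition
  by squares does not show.\<close>

lemma star_positive_iff:
  fixes h :: "'a::proper_star_algebra"
  shows "star_positive h \<longleftrightarrow> star h = h \<and>
    (\<forall>q. minimal_projection q \<longrightarrow> (\<exists>r\<ge>0. q * h * q = complex_of_real r *\<^sub>C q))"
    (is "_ \<longleftrightarrow> ?R")
proof
  assume "star_positive h"
  then show ?R
    using star_positive_selfadjoint minimal_projection_square unfolding star_positive_def by metis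
next
  assume R: ?R
  then obtain E ev where E: "orthogonal_projections E" "\<Sum>E = 1"
    "\<And>p. p \<in> E \<Longrightarrow> minimal_projection p" "\<And>p. p \<in> E \<Longrightarrow> h * p = complex_of_real (ev p) *\<^sub>C p"
    using spectral_decomposition[of h] by metis
  have "ev p \<ge> 0" if p: "p \<in> E" for p
  proof -
    have pp: "p * p = p" "p \<noteq> 0"
      using E(1) p by (auto simp: orthogonal_projections_def projection_def)
    obtain r where r: "r \<ge> 0" "p * h * p = complex_of_real r *\<^sub>C p"
      using R E(3)[OF p] by blast
    moreover have "p * h * p = complex_of_real (ev p) *\<^sub>C p"
      by (simp add: mult.assoc E(4)[OF p] mult_scaleC_right pp)
    ultimately show ?thesis
      using pp(2) by simp
  qed
  then show "star_positive h"
    using star_positive_combination[OF E(1)] spectral_sum[OF E(2,4)] by metis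
qed

lemma selfadjoint_eq_0:
  fixes h :: "'a::proper_star_algebra"
  assumes "star h = h" "\<And>q. minimal_projection q \<Longrightarrow> q * h * q = 0"
  shows "h = 0"
proof -
  obtain E ev where E: "orthogonal_projections E" "\<Sum>E = 1"
    "\<And>p. p \<in> E \<Longrightarrow> minimal_projection p" "\<And>p. p \<in> E \<Longrightarrow> h * p = complex_of_real (ev p) *\<^sub>C p"
    using spectral_decomposition[OF assms(1)] by metis
  have "h * p = 0" if p: "p \<in> E" for p
  proof -
    have "p * p = p"
      using E(1) p by (auto simp: orthogonal_projections_def projection_def)
    then have "complex_of_real (ev p) *\<^sub>C p = p * h * p"
      by (simp add: mult.assoc E(4)[OF p] mult_scaleC_right)
    then show ?thesis
      using assms(2)[OF E(3)[OF p]] E(4)[OF p] by simp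
  qed
  then show ?thesis
    using spectral_sum[OF E(2), of h "\<lambda>_. 0"] by simp
qed

lemma star_positive_add:
  fixes a b :: "'a::proper_star_algebra"
  assumes "star_positive a" "star_positive b"
  shows "star_positive (a + b)"
  unfolding star_positive_iff
proof (intro conjI allI impI)
  show "star (a + b) = a + b"
    using assms by (simp add: star_add star_positive_selfadjoint)
  fix q :: 'a
  assume "minimal_projection q"
  then obtain r s where "r \<ge> 0" "s \<ge> 0" "q * a * q = complex_of_real r *\<^sub>C q"
    "q * b * q = complex_of_real s *\<^sub>C q"
    using assms star_positive_iff by metis
  then show "\<exists>r\<ge>0. q * (a + b) * q = complex_of_real r *\<^sub>C q"
    by (intro exI[of _ "r + s"]) (simp add: distrib_left distrib_right scaleC_add_left)
qed

text \<open>In each minimal corner two nonnegative scalars add up to zero, so all compressions of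
  \<open>a\<close> vanish.\<close>

lemma star_positive_add_eq_0:
  fixes a b :: "'a::proper_star_algebra"
  assumes "star_positive a" "star_positive b" "a + b = 0"
  shows "a = 0"
proof (rule selfadjoint_eq_0)
  show "star a = a"
    using assms(1) by (rule star_positive_selfadjoint)
  fix q :: 'a
  assume q: "minimal_projection q"
  then obtain r s where rs: "r \<ge> 0" "s \<ge> 0" "q * a * q = complex_of_real r *\<^sub>C q"
    "q * b * q = complex_of_real s *\<^sub>C q"
    using assms star_positive_iff by metis
  have "q * (a + b) * q = complex_of_real (r + s) *\<^sub>C q"
    using rs by (simp add: distrib_left distrib_right scaleC_add_left)
  then have "complex_of_real (r + s) *\<^sub>C q = 0"
    using assms(3) by simp
  then have "r + s = 0"
    using q by (simp add: minimal_projection_def flip: of_real_add)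
  then show "q * a * q = 0"
    using rs by simp
qed

lemma star_positive_scaleC:
  assumes "r \<ge> 0" "star_positive a"
  shows "star_positive (complex_of_real r *\<^sub>C a)"
proof -
  obtain x where "a = star x * x"
    using assms(2) by (auto simp: star_positive_def)
  then have "complex_of_real r *\<^sub>C a =
      star (complex_of_real (sqrt r) *\<^sub>C x) * (complex_of_real (sqrt r) *\<^sub>C x)"
    using assms(1) by (simp add: star_scaleC_mult_scaleC flip: of_real_mult)
  then show ?thesis
    by (metis star_positive_def)
qed

lemma star_positive_conj:
  assumes "star_positive a"
  shows "star_positive (star x * a * x)"
proof -
  obtain y where "a = star y * y"
    using assms by (auto simp: star_positive_def)
  then have "star x * a * x = star (y * x) * (y * x)"
    by (simp add: star_mult mult.assoc)
  then show ?thesis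
    by (metis star_positive_def)
qed

text \<open>Compare \<open>s\<close> and \<open>t\<close> between an eigenprojection
  \<open>p\<close> of \<open>s\<close> and an eigenprojection \<open>q\<close> of \<open>t\<close>:
  equality of the squares forces equal eigenvalues or \<open>p * q = 0\<close>. Both families sum to
  the unit, so the blocks \<open>p * s * q\<close> determine \<open>s\<close>.\<close>

lemma star_positive_sqrt_unique:
  fixes s t :: "'a::proper_star_algebra"
  assumes "star_positive s" "star_positive t" "s * s = t * t"
  shows "s = t"
proof -
  have nonneg: "r \<ge> 0" if "star_positive x" "minimal_projection p" "x * p = complex_of_real r *\<^sub>C p"
    for x p :: 'a and r
  proof -
    have "p * x * p = complex_of_real r *\<^sub>C p" "p \<noteq> 0"
      using that(2,3)
      by (simp_all add: mult.assoc mult_scaleC_right minimal_projection_def projection_def)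
    then show ?thesis
      using that(1,2) star_positive_iff[of x] by auto
  qed
  obtain E \<mu> where E: "\<Sum>E = 1" "\<And>p. p \<in> E \<Longrightarrow> minimal_projection p"
    "\<And>p. p \<in> E \<Longrightarrow> s * p = complex_of_real (\<mu> p) *\<^sub>C p"
    "\<And>p. p \<in> E \<Longrightarrow> p * s = complex_of_real (\<mu> p) *\<^sub>C p"
    using spectral_decomposition[OF star_positive_selfadjoint[OF assms(1)]] by metis
  obtain F \<nu> where F: "\<Sum>F = 1" "\<And>p. p \<in> F \<Longrightarrow> minimal_projection p"
    "\<And>p. p \<in> F \<Longrightarrow> t * p = complex_of_real (\<nu> p) *\<^sub>C p"
    using spectral_decomposition[OF star_positive_selfadjoint[OF assms(2)]] by metis
  have "p * s * q = p * t * q" if pq: "p \<in> E" "q \<in> F" for p q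
  proof -
    have "p * (s * s) * q = p * (t * t) * q"
      by (simp add: assms(3))
    moreover have "p * (s * s) * q = complex_of_real (\<mu> p * \<mu> p) *\<^sub>C (p * q)"
      by (simp add: mult.assoc[symmetric] E(4)[OF pq(1)] mult_scaleC_left scaleC_scaleC)
    moreover have "p * (t * t) * q = complex_of_real (\<nu> q * \<nu> q) *\<^sub>C (p * q)"
      by (simp add: mult.assoc F(3)[OF pq(2)] mult_scaleC_right scaleC_scaleC)
    ultimately have "\<mu> p * \<mu> p = \<nu> q * \<nu> q \<or> p * q = 0"
      by (metis complex_vector.scale_cancel_right of_real_eq_iff)
    moreover have "\<mu> p \<ge> 0" "\<nu> q \<ge> 0"
      using nonneg assms(1,2) E(2,3) F(2,3) pq by blast+
    ultimately have "\<mu> p = \<nu> q \<or> p * q = 0"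
      by (metis abs_mult_self_eq abs_of_nonneg real_sqrt_abs2)
    then have "complex_of_real (\<mu> p) *\<^sub>C (p * q) = complex_of_real (\<nu> q) *\<^sub>C (p * q)"
      by auto
    then show ?thesis
      by (simp add: E(4)[OF pq(1)] mult_scaleC_left mult.assoc F(3)[OF pq(2)] mult_scaleC_right)
  qed
  then have "(\<Sum>p\<in>E. \<Sum>q\<in>F. p * s * q) = (\<Sum>p\<in>E. \<Sum>q\<in>F. p * t * q)"
    by simp
  moreover have "\<Sum>E * x * \<Sum>F = (\<Sum>p\<in>E. \<Sum>q\<in>F. p * x * q)" for x
    by (simp add: sum_distrib_right) (simp add: sum_distrib_left)
  ultimately have "\<Sum>E * s * \<Sum>F = \<Sum>E * t * \<Sum>F"
    by simp
  then show ?thesis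
    by (simp add: E(1) F(1))
qed

text \<open>Taking roots of the eigenvalues gives existence; with uniqueness, the definite
  description in \<open>star_sqrt\<close> denotes this root.\<close>

lemma star_sqrt:
  fixes a :: "'a::proper_star_algebra"
  assumes "star_positive a"
  shows "star_positive (star_sqrt a)" "star_sqrt a * star_sqrt a = a"
proof -
  obtain E ev where E: "orthogonal_projections E" "\<Sum>E = 1"
    "\<And>p. p \<in> E \<Longrightarrow> minimal_projection p" "\<And>p. p \<in> E \<Longrightarrow> a * p = complex_of_real (ev p) *\<^sub>C p"
    using spectral_decomposition[OF star_positive_selfadjoint[OF assms]] by metis
  have ev: "ev p \<ge> 0" if p: "p \<in> E" for p
  proof -
    have "p * a * p = complex_of_real (ev p) *\<^sub>C p" "p \<noteq> 0"
      using E(3,4)[OF p]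
      by (simp_all add: mult.assoc mult_scaleC_right minimal_projection_def projection_def)
    then show ?thesis
      using assms star_positive_iff[of a] E(3)[OF p] by auto
  qed
  let ?s = "\<Sum>p\<in>E. complex_of_real (sqrt (ev p)) *\<^sub>C p"
  have "?s * ?s = a"
    using E(1) ev spectral_sum[OF E(2,4)]
    by (simp add: orthogonal_projections_combination_mult flip: of_real_mult)
  moreover have "star_positive ?s"
    using star_positive_combination[OF E(1)] ev by simp
  ultimately have "\<exists>!s. star_positive s \<and> s * s = a"
    using star_positive_sqrt_unique by blast
  from theI'[OF this] show "star_positive (star_sqrt a)" "star_sqrt a * star_sqrt a = a"
    by (simp_all add: star_sqrt_def)
qed

section \<open>Positive maps and functionals\<close>

definition positive_map :: "('a::unital_star_algebra \<Rightarrow> 'b::unital_star_algebra) \<Rightarrow> bool"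
  where "positive_map f \<longleftrightarrow> clinear f \<and> (\<forall>a. star_positive a \<longrightarrow> star_positive (f a))"

lemma positive_map_square: "positive_map f \<Longrightarrow> star_positive (f (star x * x))"
  by (simp add: positive_map_def star_positive_square)

text \<open>For self-adjoint \<open>y\<close>, \<open>4 y = (y + 1)^2 - (y - 1)^2\<close> is a
  difference of positive elements, so its image is self-adjoint.\<close>

lemma positive_map_star:
  assumes "positive_map f"
  shows "f (star x) = star (f x)"
proof -
  have lin: "clinear f"
    using assms by (simp add: positive_map_def)
  note l = clinear_simps[OF lin]
  have sq: "star (f (star y * y)) = f (star y * y)" for y
    using positive_map_square[OF assms] star_positive_selfadjoint by blast
  have sa: "star (f y) = f y" if "star y = y" for y
  proof -
    have "star (y + 1) * (y + 1) - star (y - 1) * (y - 1) = y + y + (y + y)"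
      by (simp add: star_add star_diff that algebra_simps)
    then have "f (star (y + 1) * (y + 1)) - f (star (y - 1) * (y - 1)) = f y + f y + (f y + f y)"
      by (metis l(1,4))
    also have "\<dots> = 4 *\<^sub>C f y"
      using scaleC_add_left[of 2 2 "f y"] scaleC_add_left[of 1 1 "f y"] by simp
    finally have "f (star (y + 1) * (y + 1)) - f (star (y - 1) * (y - 1)) = 4 *\<^sub>C f y" .
    then have "star (4 *\<^sub>C f y) = 4 *\<^sub>C f y"
      by (metis sq star_diff)
    then show ?thesis
      by (simp add: star_scaleC)
  qed
  obtain u v where uv: "star u = u" "star v = v" "x = u + \<i> *\<^sub>C v"
    by (rule ex_selfadjoint_decomposition)
  then show ?thesis
    using sa[OF uv(1)] sa[OF uv(2)] by (simp add: star_add star_scaleC l)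
qed

lemma star_positive_complex_iff: "star_positive c \<longleftrightarrow> (\<exists>r\<ge>0. c = complex_of_real r)"
proof
  assume "star_positive c"
  then obtain x where "c = cnj x * x"
    by (auto simp: star_positive_def star_complex_def)
  then have "c = complex_of_real ((cmod x)\<^sup>2)"
    by (metis complex_norm_square mult.commute)
  then show "\<exists>r\<ge>0. c = complex_of_real r"
    by (metis zero_le_power2)
next
  assume "\<exists>r\<ge>0. c = complex_of_real r"
  then obtain r where "r \<ge> 0" "c = complex_of_real r"
    by blast
  then have "c = star (complex_of_real (sqrt r)) * complex_of_real (sqrt r)"
    by (simp add: star_complex_def flip: of_real_mult)
  then show "star_positive c"
    by (metis star_positive_def)
qed

text \<open>The degenerate case of Cauchy-Schwarz: without a quadratic term, the value of
  \<open>\<omega>\<close> on the square of \<open>t *\<^sub>C b + c\<close> is affine in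
  \<open>t\<close> over the reals and could be made negative.\<close>

lemma positive_functional_null:
  fixes \<omega> :: "'b::unital_star_algebra \<Rightarrow> complex"
  assumes "positive_map \<omega>" "\<omega> (star b * b) = 0"
  shows "\<omega> (star b * c) = 0"
proof (rule ccontr)
  let ?z = "\<omega> (star b * c)"
  assume z: "?z \<noteq> 0"
  have lin: "clinear \<omega>"
    using assms by (simp add: positive_map_def)
  note l = clinear_simps[OF lin]
  have cb: "\<omega> (star c * b) = cnj ?z"
    using positive_map_star[OF assms(1), of "star b * c"]
    by (simp add: star_mult star_star star_complex_def)
  obtain k where k: "k \<ge> 0" "\<omega> (star c * c) = complex_of_real k"
    using positive_map_square[OF assms(1), of c] by (auto simp: star_positive_complex_iff)
  \<comment> \<open>The factor is chosen so that the value comes out as exactly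
    \<open>- 1\<close>.\<close>
  define n where "n = (k + 1) / (2 * (cmod ?z)\<^sup>2)"
  define t where "t = - complex_of_real n * ?z"
  have "\<omega> (star (t *\<^sub>C b + c) * (t *\<^sub>C b + c)) = cnj t * ?z + t * cnj ?z + complex_of_real k"
    by (simp add: star_add star_scaleC distrib_left distrib_right mult_scaleC_left mult_scaleC_right
        l assms(2) cb k scaleC_complex_def)
  also have "\<dots> = - complex_of_real (2 * n) * (?z * cnj ?z) + complex_of_real k"
    by (simp add: t_def algebra_simps)
  also have "\<dots> = complex_of_real (k - 2 * n * (cmod ?z)\<^sup>2)"
    by (simp flip: complex_norm_square)
  also have "k - 2 * n * (cmod ?z)\<^sup>2 = - 1"
    using z by (simp add: n_def field_simps)
  finally have "star_positive (complex_of_real (- 1))"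
    using positive_map_square[OF assms(1)] by metis
  then show False
    by (auto simp: star_positive_complex_iff simp del: of_real_minus)
qed

text \<open>The state attached to \<open>q\<close>: as \<open>q\<close> is nonzero, the scalar of
  the compression is unique and hence linear in \<open>a\<close>.\<close>

lemma minimal_projection_functional:
  fixes q :: "'a::proper_star_algebra"
  assumes q: "minimal_projection q"
  obtains \<omega> where "positive_map \<omega>" "\<And>a. q * a * q = \<omega> a *\<^sub>C q"
proof -
  have q0: "q \<noteq> 0"
    using q by (simp add: minimal_projection_def)
  obtain \<omega> where \<omega>: "\<And>a. q * a * q = \<omega> a *\<^sub>C q"
    using q unfolding minimal_projection_def by metis
  have eq: "\<omega> a = c" if "q * a * q = c *\<^sub>C q" for a c
    using that \<omega>[of a] q0 by simp
  have "clinear \<omega>"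
    by (intro clinearI eq)
      (simp_all add: distrib_left distrib_right mult_scaleC_left mult_scaleC_right \<omega> scaleC_add_left
        scaleC_scaleC scaleC_complex_def)
  moreover have "star_positive (\<omega> a)" if "star_positive a" for a
    using that minimal_projection_square[OF q] eq
    unfolding star_positive_complex_iff star_positive_def by metis
  ultimately show thesis
    using \<omega> by (intro that[of \<omega>]) (simp_all add: positive_map_def)
qed

text \<open>Sum the states of a resolution of the unit into minimal projections \<open>p\<close>. If
  the sum vanishes on \<open>star x * x\<close>, each nonnegative term does, so every
  \<open>x * p\<close> is zero by properness.\<close>

lemma ex_faithful_functional:
  obtains \<tau> :: "'a::proper_star_algebra \<Rightarrow> complex"
  where "positive_map \<tau>" "\<And>x. \<tau> (star x * x) = 0 \<Longrightarrow> x = 0"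
proof -
  obtain E :: "'a set" where E: "orthogonal_projections E" "\<Sum>E = 1"
    "\<And>p. p \<in> E \<Longrightarrow> minimal_projection p"
    \<comment> \<open>Decomposing \<open>0\<close> just supplies a resolution of the unit into
      minimal projections.\<close>
    using spectral_decomposition[of 0] by (metis star_zero)
  have fin: "finite E"
    using E(1) by (simp add: orthogonal_projections_def)
  have "\<forall>p\<in>E. \<exists>\<omega>. positive_map \<omega> \<and> (\<forall>a. p * a * p = \<omega> a *\<^sub>C p)"
    using minimal_projection_functional E(3) by metis
  then obtain \<omega> where \<omega>: "\<And>p. p \<in> E \<Longrightarrow> positive_map (\<omega> p)"
    "\<And>p a. p \<in> E \<Longrightarrow> p * a * p = \<omega> p a *\<^sub>C p"
    by metis
  define \<tau> where "\<tau> a = (\<Sum>p\<in>E. \<omega> p a)" for a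
  have lin: "\<omega> p (x + y) = \<omega> p x + \<omega> p y" "\<omega> p (c *\<^sub>C x) = c *\<^sub>C \<omega> p x" if "p \<in> E" for p x y c
    using \<omega>(1)[OF that] clinear_simps(1,2)[of "\<omega> p"] by (auto simp: positive_map_def)
  have nonneg: "\<exists>r\<ge>0. \<omega> p a = complex_of_real r" if "p \<in> E" "star_positive a" for p a
    using \<omega>(1)[OF that(1)] that(2) by (simp add: positive_map_def flip: star_positive_complex_iff)
  have re: "\<omega> p a = complex_of_real (Re (\<omega> p a))" "Re (\<omega> p a) \<ge> 0"
    if "p \<in> E" "star_positive a" for p a
    using nonneg[OF that] by auto
  have \<tau>_re: "\<tau> a = complex_of_real (\<Sum>p\<in>E. Re (\<omega> p a))" if "star_positive a" for a
    unfolding \<tau>_def of_real_sum using re(1) that by (intro sum.cong) auto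
  have "clinear \<tau>"
    by (intro clinearI) (simp_all add: \<tau>_def lin sum.distrib scaleC_complex_def sum_distrib_left)
  moreover have "star_positive (\<tau> a)" if "star_positive a" for a
    using \<tau>_re[OF that] re(2) that unfolding star_positive_complex_iff by (metis sum_nonneg)
  moreover have "x = 0" if x: "\<tau> (star x * x) = 0" for x
  proof -
    have "x * p = 0" if p: "p \<in> E" for p
    proof -
      have "(\<Sum>p\<in>E. Re (\<omega> p (star x * x))) = 0"
        using x \<tau>_re[OF star_positive_square] by (metis of_real_eq_0_iff)
      then have "Re (\<omega> p (star x * x)) = 0"
        using p fin re(2)[OF _ star_positive_square] by (subst (asm) sum_nonneg_eq_0_iff) auto
      then have "\<omega> p (star x * x) = 0"
        using re(1)[OF p star_positive_square[of x]] by (metis of_real_0)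
      then have "p * (star x * x) * p = 0"
        using \<omega>(2)[OF p] by simp
      moreover have "star p = p"
        using E(1) p by (simp add: orthogonal_projections_def projection_def)
      ultimately have "star (x * p) * (x * p) = 0"
        by (simp add: star_mult mult.assoc)
      then show ?thesis
        by (rule proper)
    qed
    then have "x * \<Sum>E = 0"
      by (simp add: sum_distrib_left)
    then show "x = 0"
      by (simp add: E(2))
  qed
  ultimately show thesis
    using that by (auto simp: positive_map_def)
qed

section \<open>Slice maps and the tensor product\<close>

text \<open>This is id \<otimes> \<omega>, written as a graph map so that linearity and the values
  on pure tensors follow from \<open>graph_map\<close>.\<close>

definition slice :: "('b::unital_star_algebra \<Rightarrow> complex) \<Rightarrow> ('a::unital_star_algebra, 'b) tensor \<Rightarrow> 'a"
  where "slice \<omega> = graph_map (\<lambda>b. \<omega> b *\<^sub>C 1)"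

lemma slice:
  fixes \<omega> :: "'b::unital_star_algebra \<Rightarrow> complex" and a :: "'a::unital_star_algebra"
  assumes "clinear \<omega>"
  shows "clinear (slice \<omega> :: ('a, 'b) tensor \<Rightarrow> 'a)" "slice \<omega> (a \<otimes>\<^sub>C b) = \<omega> b *\<^sub>C a"
proof -
  have "clinear (\<lambda>b. \<omega> b *\<^sub>C (1::'a))"
    by (intro clinearI)
      (simp_all add: clinear_simps[OF assms] scaleC_add_left scaleC_complex_def scaleC_scaleC)
  from graph_map[OF this] show "clinear (slice \<omega> :: ('a, 'b) tensor \<Rightarrow> 'a)"
    "slice \<omega> (a \<otimes>\<^sub>C b) = \<omega> b *\<^sub>C a"
    by (simp_all add: slice_def mult_scaleC_right)
qed

lemma tensor_zero_left [simp]: "0 \<otimes>\<^sub>C b = 0"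
  using tensor_add_left[of 0 0 b] by simp

lemma tensor_zero_right [simp]: "a \<otimes>\<^sub>C 0 = 0"
  using tensor_add_right[of a 0 0] by simp

abbreviation tensor_sum :: "('a::complex_vector \<times> 'b::complex_vector) list \<Rightarrow> ('a, 'b) tensor"
  where "tensor_sum xs \<equiv> (\<Sum>(a, b)\<leftarrow>xs. a \<otimes>\<^sub>C b)"

lemma ex_tensor_sum: "\<exists>xs. x = tensor_sum xs"
proof (induction x rule: tensor_induct)
  case zero
  show ?case
    by (rule exI[of _ "[]"]) simp
next
  case (add a b x)
  then obtain xs where "x = tensor_sum xs"
    by blast
  then show ?case
    by (intro exI[of _ "(a, b) # xs"]) simp
qed

text \<open>
  A Gram-Schmidt step makes the second components of all other summands orthogonal to \<open>b\<close> for the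
  semi-inner product \<open>\<omega> (b\<^sup>* b')\<close>, so no cross terms remain in \<open>slice \<omega> (x\<^sup>* x)\<close>. If
  \<open>\<omega> (b\<^sup>* b) = 0\<close>, the coefficients \<open>t b'\<close> vanish because division by zero gives zero.
\<close>

lemma slice_square:
  fixes \<omega> :: "'b::unital_star_algebra \<Rightarrow> complex" and x :: "('a::proper_star_algebra, 'b) tensor"
  assumes \<omega>: "positive_map \<omega>"
  shows "star_positive (slice \<omega> (star x * x)) \<and>
    ((\<forall>b. \<omega> (star b * b) = 0 \<longrightarrow> b = 0) \<longrightarrow> slice \<omega> (star x * x) = 0 \<longrightarrow> x = 0)"
proof -
  have lin: "clinear \<omega>"
    using \<omega> by (simp add: positive_map_def)
  note l = clinear_simps[OF lin] and s = slice(2)[OF lin] clinear_simps[OF slice(1)[OF lin]]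
  obtain xs where "x = tensor_sum xs"
    using ex_tensor_sum by blast
  then show ?thesis
  \<comment> \<open>The hypothesis is applied to the orthogonalized list \<open>ys'\<close>, which
    is not the tail of \<open>xs\<close> but has the same length.\<close>
  proof (induction "length xs" arbitrary: xs x)
    case 0
    then show ?case
      by (simp add: s star_positive_def exI[of _ 0])
  next
    case (Suc n)
    then obtain a b ys where xs: "xs = (a, b) # ys"
      by (metis length_Suc_conv surj_pair)
    define t where "t b' = \<omega> (star b * b') / \<omega> (star b * b)" for b'
    define ys' where "ys' = map (\<lambda>(a', b'). (a', b' - t b' *\<^sub>C b)) ys"
    define a0 where "a0 = a + (\<Sum>(a', b')\<leftarrow>ys. t b' *\<^sub>C a')"
    define y where "y = tensor_sum ys'"
    have "tensor_sum ys = tensor_sum ys' + (\<Sum>(a', b')\<leftarrow>ys. t b' *\<^sub>C a') \<otimes>\<^sub>C b"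
    proof -
      have split: "a' \<otimes>\<^sub>C b' = a' \<otimes>\<^sub>C (b' - t b' *\<^sub>C b) + (t b' *\<^sub>C a') \<otimes>\<^sub>C b" for a' :: 'a and b'
        using tensor_add_right[of a' "b' - t b' *\<^sub>C b" "t b' *\<^sub>C b"]
        by (simp add: tensor_scaleC_left tensor_scaleC_right)
      show ?thesis
        unfolding ys'_def
      proof (induction ys)
        case (Cons p ys)
        obtain a' b' where p: "p = (a', b')"
          by fastforce
        show ?case
          using Cons split[of a' b'] by (simp add: p tensor_add_left add_ac)
      qed simp
    qed
    then have x: "x = a0 \<otimes>\<^sub>C b + y"
      using Suc.prems by (simp add: xs y_def a0_def tensor_add_left)
    \<comment> \<open>If \<open>\<omega> (star b * b) = 0\<close>, nothing is subtracted, and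
      orthogonality comes from \<open>positive_functional_null\<close>.\<close>
    have orth: "\<omega> (star b * (b' - t b' *\<^sub>C b)) = 0" for b'
      using positive_functional_null[OF \<omega>, of b b']
      by (cases "\<omega> (star b * b) = 0")
        (simp_all add: right_diff_distrib mult_scaleC_right l t_def scaleC_complex_def)
    have orth': "\<omega> (star (b' - t b' *\<^sub>C b) * b) = 0" for b'
      using positive_map_star[OF \<omega>, of "star b * (b' - t b' *\<^sub>C b)"] orth[of b']
      by (simp add: star_mult star_star)
    have "slice \<omega> (star (a0 \<otimes>\<^sub>C b) * y) = 0"
      unfolding y_def ys'_def
      by (induction ys) (auto simp: s distrib_left tensor_star_pure tensor_mult_pure orth)
    moreover have "slice \<omega> (star y * (a0 \<otimes>\<^sub>C b)) = 0"
      unfolding y_def ys'_def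
      by (induction ys) (auto simp: s star_add distrib_right tensor_star_pure tensor_mult_pure orth')
    ultimately have sl: "slice \<omega> (star x * x) =
        \<omega> (star b * b) *\<^sub>C (star a0 * a0) + slice \<omega> (star y * y)"
      by (simp add: x star_add distrib_left distrib_right s tensor_star_pure tensor_mult_pure)
    have "length ys' = n"
      using Suc.hyps(2) by (simp add: ys'_def xs)
    note IH = Suc.hyps(1)[OF this[symmetric] y_def]
    obtain r where r: "r \<ge> 0" "\<omega> (star b * b) = complex_of_real r"
      using positive_map_square[OF \<omega>] by (auto simp: star_positive_complex_iff)
    have pos: "star_positive (\<omega> (star b * b) *\<^sub>C (star a0 * a0))"
      unfolding r(2) by (intro star_positive_scaleC r(1) star_positive_square)
    \<comment> \<open>Both positive summands vanish. The induction hypothesis gives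
      \<open>y = 0\<close>, and the first summand forces \<open>b = 0\<close> or
      \<open>a0 = 0\<close>.\<close>
    have "x = 0" if faithful: "\<forall>b. \<omega> (star b * b) = 0 \<longrightarrow> b = 0" and "slice \<omega> (star x * x) = 0"
    proof -
      have "\<omega> (star b * b) *\<^sub>C (star a0 * a0) = 0"
        using star_positive_add_eq_0[OF pos] IH that(2) sl by metis
      then have "y = 0" "\<omega> (star b * b) = 0 \<or> star a0 * a0 = 0"
        using IH that sl by auto
      then show ?thesis
        using faithful proper[of a0] by (auto simp: x)
    qed
    then show ?case
      using star_positive_add[OF pos] IH sl by simp
  qed
qed

text \<open>Slicing by a faithful functional on the second factor gives properness, and the products
  of two finite spanning sets span. Square roots thereby exist in the tensor product.\<close>

instance tensor :: (proper_star_algebra, proper_star_algebra) proper_star_algebra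
proof
  fix x :: "('a, 'b) tensor"
  obtain \<tau> :: "'b \<Rightarrow> complex" where \<tau>: "positive_map \<tau>" "\<And>x. \<tau> (star x * x) = 0 \<Longrightarrow> x = 0"
    by (rule ex_faithful_functional) blast
  have "slice \<tau> 0 = (0::'a)"
    using clinear_simps(3)[OF slice(1)] \<tau>(1) by (auto simp: positive_map_def)
  then show "x = 0" if "star x * x = 0"
    using slice_square[OF \<tau>(1), of x] \<tau>(2) that by auto
next
  obtain S :: "'a set" where S: "finite S" "\<forall>x. \<exists>c. x = (\<Sum>s\<in>S. c s *\<^sub>C s)"
    using finite_spanning by blast
  obtain T :: "'b set" where T: "finite T" "\<forall>x. \<exists>c. x = (\<Sum>s\<in>T. c s *\<^sub>C s)"
    using finite_spanning by blast
  let ?U = "(\<lambda>(s, t). s \<otimes>\<^sub>C t) ` (S \<times> T)"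
  have "x \<in> complex_vector.span ?U" for x :: "('a, 'b) tensor"
  proof (induction x rule: tensor_induct)
    case zero
    show ?case
      by (rule complex_vector.span_zero)
  next
    case (add a b x)
    have sum_left: "(\<Sum>s\<in>S'. c s *\<^sub>C s) \<otimes>\<^sub>C b' = (\<Sum>s\<in>S'. c s *\<^sub>C (s \<otimes>\<^sub>C b'))"
      for S' :: "'a set" and c and b' :: 'b
      by (induction S' rule: infinite_finite_induct)
        (simp_all add: tensor_add_left tensor_scaleC_left)
    have sum_right: "a' \<otimes>\<^sub>C (\<Sum>t\<in>T'. c t *\<^sub>C t) = (\<Sum>t\<in>T'. c t *\<^sub>C (a' \<otimes>\<^sub>C t))"
      for T' :: "'b set" and c and a' :: 'a
      by (induction T' rule: infinite_finite_induct)
        (simp_all add: tensor_add_right tensor_scaleC_right)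
    obtain c d where a: "a = (\<Sum>s\<in>S. c s *\<^sub>C s)" and b: "b = (\<Sum>s\<in>T. d s *\<^sub>C s)"
      using S(2) T(2) by metis
    have "a \<otimes>\<^sub>C b \<in> complex_vector.span ?U"
      unfolding a sum_left unfolding b sum_right
      by (intro complex_vector.span_sum complex_vector.span_scale complex_vector.span_base) auto
    then show ?case
      using add complex_vector.span_add by blast
  qed
  then show "\<exists>U::('a, 'b) tensor set. finite U \<and> (\<forall>x. \<exists>c. x = (\<Sum>s\<in>U. c s *\<^sub>C s))"
    using S(1) T(1) complex_vector.span_finite[of ?U] by (intro exI[of _ ?U]) auto
qed

section \<open>The graph map and the decomposition\<close>

text \<open>
  On the corner of a minimal projection \<open>q\<close> the central elements \<open>f b\<close> act as scalars \<open>\<omega> b\<close>, so the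
  graph map is seen by \<open>q\<close> as the slice map of the functional \<open>\<omega>\<close>.
\<close>

lemma graph_map_positive:
  fixes f :: "'b::proper_star_algebra \<Rightarrow> 'a::proper_star_algebra"
  assumes f: "positive_map f" and central: "range f \<subseteq> star_center"
  shows "positive_map (graph_map f)"
proof -
  have lin: "clinear f"
    using f by (simp add: positive_map_def)
  note g = graph_map(2)[OF lin] clinear_simps[OF graph_map(1)[OF lin]]
  have comm: "a * f b = f b * a" for a b
  proof -
    have "f b \<in> star_center"
      using central by blast
    then show ?thesis
      by (simp add: star_center_def)
  qed
  have star: "graph_map f (star x) = star (graph_map f x)" for x
  proof (induction x rule: tensor_induct)
    case (add a b x)
    \<comment> \<open>Centrality undoes the reversal of factors by \<open>star\<close>.\<close>
    have "star a * f (star b) = star (a * f b)"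
      by (metis comm positive_map_star[OF f] star_mult)
    then show ?case
      by (simp add: add g star_add tensor_star_pure)
  qed (simp add: g)
  have "star_positive (graph_map f (star x * x))" for x
    unfolding star_positive_iff
  proof (intro conjI allI impI)
    show "star (graph_map f (star x * x)) = graph_map f (star x * x)"
      by (simp add: star_mult star_star flip: star)
    fix q :: 'a
    assume q: "minimal_projection q"
    then have qq: "q * q = q"
      by (simp add: minimal_projection_def projection_def)
    obtain \<rho> where \<rho>: "positive_map \<rho>" "\<And>a. q * a * q = \<rho> a *\<^sub>C q"
      using minimal_projection_functional[OF q] by blast
    define \<omega> where "\<omega> b = \<rho> (f b)" for b
    have \<omega>: "positive_map \<omega>"
      using \<rho>(1) f clinear_simps(1,2)[of f] clinear_simps(1,2)[of \<rho>]
      by (auto simp: positive_map_def \<omega>_def intro!: clinearI)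
    then have lin': "clinear \<omega>"
      by (simp add: positive_map_def)
    have fq: "f b * q = \<omega> b *\<^sub>C q" for b
    proof -
      have "f b * q = q * f b * q"
        by (metis comm mult.assoc qq)
      then show ?thesis
        by (simp add: \<omega>_def \<rho>(2))
    qed
    \<comment> \<open>The compressions to \<open>q\<close> agree on pure tensors by
      \<open>fq\<close>, so positivity of the slice transfers to the graph map.\<close>
    have "q * graph_map f y * q = q * slice \<omega> y * q" for y
    proof (induction y rule: tensor_induct)
      case (add a b y)
      have "q * (a * f b) * q = q * (\<omega> b *\<^sub>C a) * q"
        by (simp add: mult.assoc fq mult_scaleC_left mult_scaleC_right)
      then show ?case
        by (simp add: g slice(2)[OF lin'] clinear_simps[OF slice(1)[OF lin']] distrib_left
            distrib_right add)
    qed (simp add: g clinear_simps[OF slice(1)[OF lin']])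
    then show "\<exists>r\<ge>0. q * graph_map f (star x * x) * q = complex_of_real r *\<^sub>C q"
      using slice_square[OF \<omega>, of x] q star_positive_iff[of "slice \<omega> (star x * x)"] by simp
  qed
  then show ?thesis
    using graph_map(1)[OF lin] by (auto simp: positive_map_def star_positive_def)
qed

section \<open>Inverses and the conditional maps\<close>

lemma star_inverse:
  assumes "star_invertible a"
  shows "a * star_inverse a = 1" "star_inverse a * a = 1"
proof -
  obtain b where b: "a * b = 1" "b * a = 1"
    using assms by (auto simp: star_invertible_def)
  have "c = b" if "c * a = 1" for c
  proof -
    have "c = c * a * b"
      by (simp add: mult.assoc b)
    then show ?thesis
      by (simp add: that)
  qed
  with b have "\<exists>!b. a * b = 1 \<and> b * a = 1"
    by blast
  from theI'[OF this] show "a * star_inverse a = 1" "star_inverse a * a = 1"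
    by (simp_all add: star_inverse_def)
qed

lemma star_star_inverse:
  assumes "star_invertible a" "star a = a"
  shows "star (star_inverse a) = star_inverse a"
proof -
  have "star (star_inverse a) * a = 1"
    using arg_cong[OF star_inverse(1)[OF assms(1)], of star] assms(2) by (simp add: star_mult)
  then show ?thesis
    using star_inverse[OF assms(1)] by (metis mult.assoc mult.left_neutral mult.right_neutral)
qed

text \<open>If \<open>b\<close> inverts \<open>a = s * s\<close>, then \<open>s * b\<close> is a
  right inverse and \<open>b * s\<close> a left inverse of \<open>s\<close>, so they
  coincide.\<close>

lemma star_sqrt_invertible:
  fixes a :: "'a::proper_star_algebra"
  assumes "star_positive a" "star_invertible a"
  shows "star_invertible (star_sqrt a)"
proof -
  obtain b where "a * b = 1" "b * a = 1"
    using assms(2) by (auto simp: star_invertible_def)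
  then have "star_sqrt a * (star_sqrt a * b) = 1" "(b * star_sqrt a) * star_sqrt a = 1"
    using star_sqrt(2)[OF assms(1)] by (metis mult.assoc)+
  then show ?thesis
    unfolding star_invertible_def by (metis mult.assoc mult.left_neutral mult.right_neutral)
qed

text \<open>Taking \<open>d\<close> as \<open>e\<close> and as \<open>1 - e\<close> gives the two
  conditional maps. Each stage preserves positivity, and at \<open>1\<close> the inner value is
  \<open>graph_map f d\<close>, which the two factors \<open>u\<close> cancel.\<close>

lemma conj_graph_map_positive_unital:
  fixes f :: "'b::proper_star_algebra \<Rightarrow> 'a::proper_star_algebra" and d :: "('a, 'b) tensor"
  assumes f: "positive_map f" "range f \<subseteq> star_center"
    and d: "star_positive d" and inv: "star_invertible (graph_map f d)"
  defines "u \<equiv> star_inverse (star_sqrt (graph_map f d))"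
  shows "positive_unital_map (\<lambda>b. u * graph_map f (star_sqrt d * (1 \<otimes>\<^sub>C b) * star_sqrt d) * u)"
proof -
  note gr = graph_map_positive[OF f]
  have lin: "clinear (graph_map f)"
    using gr by (simp add: positive_map_def)
  have G: "star_positive (graph_map f d)"
    using gr d by (simp add: positive_map_def)
  have si: "star_invertible (star_sqrt (graph_map f d))"
    by (rule star_sqrt_invertible[OF G inv])
  have u: "star u = u"
    unfolding u_def by (intro star_star_inverse si star_positive_selfadjoint star_sqrt(1) G)
  note l = clinear_simps[OF lin]
  let ?g = "\<lambda>b. u * graph_map f (star_sqrt d * (1 \<otimes>\<^sub>C b) * star_sqrt d) * u"
  have "clinear ?g"
    by (intro clinearI) (simp_all add: tensor_add_right tensor_scaleC_right distrib_left
        distrib_right mult_scaleC_left mult_scaleC_right l)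
  moreover have "star_positive (?g b)" if "star_positive b" for b
  proof -
    obtain y where "b = star y * y"
      using \<open>star_positive b\<close> by (auto simp: star_positive_def)
    then have "1 \<otimes>\<^sub>C b = star (1 \<otimes>\<^sub>C y) * ((1::'a) \<otimes>\<^sub>C y)"
      by (simp add: tensor_star_pure tensor_mult_pure)
    then have "star_positive ((1::'a) \<otimes>\<^sub>C b)"
      using star_positive_square by metis
    then have "star_positive (star_sqrt d * (1 \<otimes>\<^sub>C b) * star_sqrt d)"
      using star_positive_conj[of _ "star_sqrt d"] star_positive_selfadjoint[OF star_sqrt(1)[OF d]]
      by metis
    then have "star_positive (graph_map f (star_sqrt d * (1 \<otimes>\<^sub>C b) * star_sqrt d))"
      using gr by (simp add: positive_map_def)
    then show ?thesis
      using star_positive_conj[of _ u] u by metis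
  qed
  moreover have "?g 1 = 1"
  proof -
    have "?g 1 = u * (star_sqrt (graph_map f d) * star_sqrt (graph_map f d)) * u"
      by (simp add: star_sqrt(2)[OF d] star_sqrt(2)[OF G] flip: tensor_one)
    also have "\<dots> = (u * star_sqrt (graph_map f d)) * (star_sqrt (graph_map f d) * u)"
      by (simp add: mult.assoc)
    also have "\<dots> = 1"
      using star_inverse[OF si] by (simp add: u_def)
    finally show ?thesis .
  qed
  ultimately show ?thesis
    by (simp add: positive_unital_map_def)
qed

theorem theorem11:
  fixes f :: "'b::fd_cstar_algebra \<Rightarrow> 'a::fd_cstar_algebra"
    and e :: "('a, 'b) tensor"
  assumes "positive_unital_map f" and "range f \<subseteq> star_center"
    and "e \<in> star_effects"
    and "star_invertible (graph_map f e)" and "star_invertible (graph_map f (1 - e))"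
  shows "(\<exists>!(gh :: ('b \<Rightarrow> 'a) \<times> ('b \<Rightarrow> 'a)). case gh of (g, h) \<Rightarrow>
      positive_unital_map g \<and> positive_unital_map h \<and>
      char_map (graph_map f e) \<circ> map_prod g h = joint_map f e) \<and>
    (\<forall>g h. positive_unital_map g \<and> positive_unital_map h \<and>
      char_map (graph_map f e) \<circ> map_prod g h = joint_map f e \<longrightarrow>
      (\<forall>b. g b = star_inverse (star_sqrt (graph_map f e)) * joint_map f e (b, 0) *
          star_inverse (star_sqrt (graph_map f e))) \<and>
      (\<forall>b. h b = star_inverse (star_sqrt (graph_map f (1 - e))) * joint_map f e (0, b) *
          star_inverse (star_sqrt (graph_map f (1 - e)))))"
proof -
  have f: "positive_map f" "f 1 = 1"
    using assms(1) by (simp_all add: positive_unital_map_def positive_map_def)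
  then have linf: "clinear f"
    by (simp add: positive_map_def)
  note gr = graph_map_positive[OF f(1) assms(2)]
  note l = clinear_simps[OF graph_map(1)[OF linf]]
  have e: "star_positive e" "star_positive (1 - e)"
    using assms(3) by (simp_all add: star_effects_def star_le_def)
  \<comment> \<open>Identifies the second root in \<open>char_map (graph_map f e)\<close> with the
    root of the invertible element \<open>graph_map f (1 - e)\<close>.\<close>
  have one: "graph_map f (1 - e) = 1 - graph_map f e"
    using graph_map(2)[OF linf, of 1 1] f(2) by (simp add: l tensor_one)
  define s where "s = star_sqrt (graph_map f e)"
  define t where "t = star_sqrt (graph_map f (1 - e))"
  define u where "u = star_inverse s"
  define v where "v = star_inverse t"
  have G: "star_positive (graph_map f e)" "star_positive (graph_map f (1 - e))"
    using gr e by (simp_all add: positive_map_def)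
  have inv: "s * u = 1" "u * s = 1" "t * v = 1" "v * t = 1"
    unfolding u_def v_def s_def t_def
    by (intro star_inverse star_sqrt_invertible G assms(4,5))+
  define g0 where "g0 b = u * joint_map f e (b, 0) * u" for b
  define h0 where "h0 b = v * joint_map f e (0, b) * v" for b
  have joint: "joint_map f e (b, c) = joint_map f e (b, 0) + joint_map f e (0, c)" for b c
    by (simp add: joint_map_def char_map_def l)
  define Q where "Q g h \<longleftrightarrow> positive_unital_map g \<and> positive_unital_map h \<and>
    char_map (graph_map f e) \<circ> map_prod g h = joint_map f e" for g h
  have "positive_unital_map g0"
    using conj_graph_map_positive_unital[OF f(1) assms(2) e(1) assms(4)]
    unfolding g0_def by (simp add: joint_map_def char_map_def u_def s_def)
  moreover have "positive_unital_map h0"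
    using conj_graph_map_positive_unital[OF f(1) assms(2) e(2) assms(5)]
    unfolding h0_def by (simp add: joint_map_def char_map_def v_def t_def)
  moreover have "char_map (graph_map f e) \<circ> map_prod g0 h0 = joint_map f e"
  proof
    fix bc :: "'b \<times> 'b"
    obtain b c where bc: "bc = (b, c)"
      by fastforce
    have "(char_map (graph_map f e) \<circ> map_prod g0 h0) bc = s * g0 b * s + t * h0 c * t"
      by (simp add: bc char_map_def s_def t_def one)
    also have "s * g0 b * s = (s * u) * joint_map f e (b, 0) * (u * s)"
      by (simp add: g0_def mult.assoc)
    also have "t * h0 c * t = (t * v) * joint_map f e (0, c) * (v * t)"
      by (simp add: h0_def mult.assoc)
    finally show "(char_map (graph_map f e) \<circ> map_prod g0 h0) bc = joint_map f e bc"
      by (simp add: inv bc joint[of b c])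
  qed
  ultimately have ex: "Q g0 h0"
    by (simp add: Q_def)
  have unique: "g = g0" "h = h0" if "Q g h" for g h
  proof -
    from that have gh: "positive_unital_map g" "positive_unital_map h"
      "char_map (graph_map f e) \<circ> map_prod g h = joint_map f e"
      by (simp_all add: Q_def)
    \<comment> \<open>Setting one argument of the joint map to \<open>0\<close> isolates the other
      map, and the invertible roots can then be cancelled on both sides.\<close>
    have zero: "g 0 = 0" "h 0 = 0"
      using gh clinear_simps(3) by (auto simp: positive_unital_map_def)
    have J: "joint_map f e (b, c) = s * g b * s + t * h c * t" for b c
      using fun_cong[OF gh(3), of "(b, c)"] by (simp add: char_map_def s_def t_def one)
    have "g0 b = (u * s) * g b * (s * u)" "h0 b = (v * t) * h b * (t * v)" for b
      by (simp_all add: g0_def h0_def J zero mult.assoc)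
    then show "g = g0" "h = h0"
      by (simp_all add: inv fun_eq_iff)
  qed
  have "\<exists>!gh. case gh of (g, h) \<Rightarrow> Q g h"
  proof (rule ex1I[of _ "(g0, h0)"])
    fix gh
    assume "case gh of (g, h) \<Rightarrow> Q g h"
    then show "gh = (g0, h0)"
      using unique[of "fst gh" "snd gh"] by (simp add: case_prod_unfold prod_eq_iff)
  qed (simp add: ex)
  moreover have "g b = u * joint_map f e (b, 0) * u" "h b = v * joint_map f e (0, b) * v"
    if "Q g h" for g h b
    using unique[OF that] by (simp_all add: g0_def h0_def)
  ultimately show ?thesis
    unfolding Q_def u_def v_def s_def t_def by blast
qed

end
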